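(* Let $\bm Z=(\bm X_i,f(\bm X_i))_{i=1}^n$ with $\bm X_1,\dots,\bm X_n$ independent and identically distributed according to $\rho$ on $\Omega$. Let $\Xi=\Xi(h,C_1,C_2)\subseteq(\Omega\times Y)^n$ be the set of admissible samples (defined in the context), let $\gamma=1-\mathbb P\{\bm Z\in\Xi\}$, and let $$m=\mathbb E\{\mathcal E(R_h(\bm Z_{-i}))\mid\bm Z\in\Xi\}$$ be the expected value of the risk functional $\mathcal E(R_h(\bm Z_{-i}))$ restricted to $\Xi$. Then for every $\varepsilon>2\gamma nC_1C_2$ and $1\le i\le n$, \begin{align*} \mathbb P\left\{\left|\mathcal E(R_h(\bm Z_{-i}))-m\right|>\varepsilon\right\} &\le2\gamma+2\exp\left(-\left(\frac{\varepsilon}{\sqrt{2n}\,C_1C_2}-\sqrt{2n}\,\gamma\right)^2\right)\\ &\le2\gamma+2\exp\left(-\left(\frac{\varepsilon}{\sqrt{8n}\,C_1^2}-\sqrt{2n}\,\gamma\right)^2\right). \end{align*}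
   Context: $(\Omega,\rho)$ is a probability space, $Y\subseteq\mathbb C$ is a set of values with absolute value $|\cdot|$, and $f\colon\Omega\to Y$ is the function to be approximated. A reconstruction method $R_h$ assigns to a finite list of samples in $\Omega\times Y$ (here lists of length $n-1$) a function $\Omega\to Y$; $h$ is a label for the method/parameter. $\|g\|_\infty=\sup_{\bm x\in\Omega}|g(\bm x)|$. All functions and sets are tacitly assumed measurable where needed. For $\bm z=(z_1,\dots,z_n)\in(\Omega\times Y)^n$ put $\bm z_{-i}=(z_1,\dots,z_{i-1},z_{i+1},\dots,z_n)$. Risk functional: $\mathcal E(g)=\int_\Omega|g(\bm x)-f(\bm x)|^2\,\mathrm d\rho(\bm x)$ for $g\colon\Omega\to Y$. Conditional expectation given an event $B$: $\mathbb E\{X\mid B\}=\mathbb E\{\mathbf 1_BX\}/\mathbb P\{B\}$; it is assumed that $\mathbb P\{\bm Z\in\Xi\}>0$. Set of admissible samples: for constants $C_1,C_2>0$ with $C_2\le 2C_1$, $\Xi=\Xi(h,C_1,C_2)\subseteq(\Omega\times Y)^n$ denotes a set of samples for which (i) $\|R_h(\bm z_{-i})-f\|_\infty<C_1$ for all $\bm z\in\Xi$ and $1\le i\le n$; (ii) for every $\bm x\in\Omega$ and $1\le i\le n$ the map $\bm z_{-i}\mapsto R_h(\bm z_{-i})(\bm x)$ is $C_2\mathbf 1$-bounded on $\Xi$, i.e. $|R_h(\bm z_{-i})(\bm x)-R_h(\bm z'_{-i})(\bm x)|\le C_2\cdot\#\{j\ne i: z_j\ne z_j'\}$ for all $\bm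 z,\bm z'\in\Xi$.
   Formalization: The second inequality, between the two right-hand sides, fails for some ε; it is claimed only when the sum of the two bracketed expressions is ≥ 0 (exactly when it holds). Both right-hand sides are still shown to bound the probability for every ε > 2γnC₁C₂. *)

theory Defs
  imports "HOL-Probability.Probability"
begin

text \<open>
  Samples \<open>z = (z_1, ..., z_n)\<close> of \<open>(\<Omega> \<times> Y)^n\<close> are functions on the index set \<open>{1..n}\<close>, extended
  by \<open>undefined\<close> (so they are the points of the product measure space). A reconstruction method
  takes a list of samples, so \<open>z_{-i}\<close> is a list of length \<open>n - 1\<close>.
\<close>

definition leave_out :: "nat \<Rightarrow> (nat \<Rightarrow> 's) \<Rightarrow> nat \<Rightarrow> 's list" where
  "leave_out n z i = map z (filter (\<lambda>j. j \<noteq> i) [1..<Suc n])"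

text \<open>
  Sup norm, risk and conditional expectation take values in the extended nonnegative reals: an
  unbounded function has sup norm \<open>\<infinity>\<close> and a function that is not square integrable has risk \<open>\<infinity>\<close>.
\<close>

definition sup_norm :: "'a set \<Rightarrow> ('a \<Rightarrow> complex) \<Rightarrow> ennreal" where
  "sup_norm \<Omega> g = (SUP x\<in>\<Omega>. ennreal (cmod (g x)))"

definition risk :: "'a measure \<Rightarrow> ('a \<Rightarrow> complex) \<Rightarrow> ('a \<Rightarrow> complex) \<Rightarrow> ennreal" where
  "risk \<rho> f g = (\<integral>\<^sup>+x. ennreal ((cmod (g x - f x))\<^sup>2) \<partial>\<rho>)"

definition expectation_given :: "'w measure \<Rightarrow> ('w \<Rightarrow> ennreal) \<Rightarrow> 'w set \<Rightarrow> ennreal" where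
  "expectation_given P X B = (\<integral>\<^sup>+\<omega>. indicator B \<omega> * X \<omega> \<partial>P) / emeasure P B"

definition admissible_samples ::
  "'a set \<Rightarrow> complex set \<Rightarrow> ('a \<Rightarrow> complex) \<Rightarrow> (('a \<times> complex) list \<Rightarrow> 'a \<Rightarrow> complex) \<Rightarrow>
   nat \<Rightarrow> real \<Rightarrow> real \<Rightarrow> (nat \<Rightarrow> 'a \<times> complex) set \<Rightarrow> bool" where
  "admissible_samples \<Omega> Y f R n C1 C2 \<Xi> \<longleftrightarrow>
     \<Xi> \<subseteq> ({1..n} \<rightarrow>\<^sub>E \<Omega> \<times> Y) \<and>
     (\<forall>z\<in>\<Xi>. \<forall>i\<in>{1..n}. sup_norm \<Omega> (\<lambda>x. R (leave_out n z i) x - f x) < ennreal C1) \<and>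
     (\<forall>x\<in>\<Omega>. \<forall>i\<in>{1..n}. \<forall>z\<in>\<Xi>. \<forall>z'\<in>\<Xi>.
        cmod (R (leave_out n z i) x - R (leave_out n z' i) x)
          \<le> C2 * real (card {j \<in> {1..n} - {i}. z j \<noteq> z' j}))"

end

theory Submission
  imports Defs
begin

text \<open>
  Put \<open>c = 2 C\<^sub>1 C\<^sub>2\<close>. On \<open>\<Xi>\<close> the risk is \<open>c\<close>-Lipschitz for the Hamming distance, so it has a
  McShane extension \<open>L\<close> to all samples. Since \<open>L\<close> need not be measurable, it is replaced by a
  measurable majorant \<open>G\<close> of minimal integral. By minimality, changing one coordinate changes \<open>G\<close> by
  at most \<open>c\<close> almost surely, and \<open>G\<close> still is the risk on \<open>\<Xi>\<close>; hence McDiarmid's bound for the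
  moment generating function applies to \<open>G\<close>.

  The shift \<open>\<delta> = m - E(G)\<close> satisfies \<open>\<bar>\<delta>\<bar> \<le> \<gamma> n c\<close>, which gives the bound with \<open>a\<close> and, as \<open>\<bar>b\<bar> \<le> a\<close>
  when \<open>a + b \<ge> 0\<close>, also the one with \<open>b\<close>. If \<open>a + b < 0\<close>, then \<open>b\<close> is negative with
  \<open>b\<^sup>2 \<le> 2 n \<gamma>\<^sup>2\<close>, and the crude bound on \<open>\<delta>\<close> is not enough. There one uses
  \<open>1 - \<gamma> \<le> exp (- 2 \<delta>\<^sup>2 / (n c\<^sup>2))\<close>, a consequence of the exponential moment bound, and the opposite
  effects of \<open>\<delta>\<close> on the two tails: a second difference of the Gaussian is at most \<open>\<gamma>\<close>.
\<close>

section \<open>A second difference of the Gaussian\<close>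

text \<open>Compares Taylor coefficients in \<open>cosh_minus_one_le\<close>. Equality holds at
  \<open>k = 0\<close> and \<open>k = 1\<close>, so 12 is the largest possible base. Going from
  \<open>k\<close> to \<open>k + 1\<close> multiplies the left side by \<open>12 (k + 1)\<close> and
  the right side by \<open>(2 k + 4) (2 k + 3)\<close>, which is no smaller.\<close>

lemma two_pow12_fact_le: "2 * 12 ^ k * fact k \<le> (fact (2 * k + 2) :: real)"
proof (induction k)
  case (Suc k)
  have "2 * 12 ^ Suc k * fact (Suc k) = 12 * (real k + 1) * (2 * 12 ^ k * fact k)"
    by (simp add: algebra_simps)
  also have "\<dots> \<le> 12 * (real k + 1) * fact (2 * k + 2)"
    using Suc by (intro mult_left_mono) auto
  also have "\<dots> \<le> ((2 * real k + 4) * (2 * real k + 3)) * fact (2 * k + 2)"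
    by (intro mult_right_mono) (auto simp: algebra_simps)
  also have "\<dots> = fact (2 * Suc k + 2)"
    by (simp add: algebra_simps)
  finally show ?case .
qed (simp add: numeral_eq_Suc)

text \<open>Both sides are power series in \<open>w\<^sup>2\<close> and are compared term by term.
  They agree through the term in \<open>w ^ 4\<close>, which fixes the constant 12.\<close>

lemma cosh_minus_one_le:
  fixes w :: real
  shows "2 * (cosh w - 1) \<le> w\<^sup>2 * exp (w\<^sup>2 / 12)"
proof -
  define a where "a k = 2 * (if even k then w ^ k /\<^sub>R fact k else 0)" for k :: nat
  define b where "b k = w\<^sup>2 * ((w\<^sup>2 / 12) ^ k /\<^sub>R fact k)" for k :: nat
  have "a sums (2 * cosh w)"
    unfolding a_def by (intro sums_mult cosh_converges)
  \<comment> \<open>The odd terms vanish, so only even indices remain; splitting off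
    \<open>a 0 = 2\<close> then shifts the index by one.\<close>
  hence "(\<lambda>k. a (2 * k)) sums (2 * cosh w)"
    by (subst sums_mono_reindex) (auto simp: strict_mono_def a_def elim!: evenE)
  hence a: "(\<lambda>k. a (2 * Suc k)) sums (2 * cosh w - a 0)"
    by (subst sums_Suc_iff) simp
  have b: "b sums (w\<^sup>2 * exp (w\<^sup>2 / 12))"
    unfolding b_def by (intro sums_mult exp_converges)
  have "a (2 * Suc k) \<le> b k" for k
  proof -
    have "a (2 * Suc k) = 2 * (w ^ (2 * Suc k) / fact (2 * Suc k))"
      by (simp only: a_def even_mult_iff even_numeral simp_thms if_True scaleR_conv_of_real
          of_real_eq_id id_apply divide_inverse_commute)
    also have "\<dots> = (w\<^sup>2) ^ Suc k * (2 / fact (2 * k + 2))"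
      unfolding power_mult by simp
    also have "2 / fact (2 * k + 2) \<le> 1 / (12 ^ k * fact k :: real)"
      using two_pow12_fact_le[of k] by (simp add: field_simps del: fact_Suc)
    hence "(w\<^sup>2) ^ Suc k * (2 / fact (2 * k + 2)) \<le> (w\<^sup>2) ^ Suc k * (1 / (12 ^ k * fact k))"
      by (intro mult_left_mono) auto
    also have "\<dots> = b k"
      by (simp add: b_def power_divide divide_simps)
    finally show ?thesis .
  qed
  hence "2 * cosh w - a 0 \<le> w\<^sup>2 * exp (w\<^sup>2 / 12)"
    by (rule sums_le[OF _ a b])
  thus ?thesis by (simp add: a_def)
qed

text \<open>Division by \<open>exp (x / 2)\<close> turns this into
  \<open>x / 2 \<le> sinh (x / 2)\<close>. The difference of the two sides has the derivative
  \<open>exp (x / 2) * (exp (x / 2) - 1 - x / 2)\<close>, which is nonnegative.\<close>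

lemma mult_exp_half_le:
  fixes x :: real
  assumes "0 \<le> x"
  shows "x * exp (x / 2) \<le> exp x - 1"
proof -
  define g :: "real \<Rightarrow> real" where "g y = exp y - 1 - y * exp (y / 2)" for y
  have "g 0 \<le> g x"
  proof (rule DERIV_nonneg_imp_nondecreasing[OF assms])
    fix y :: real assume "0 \<le> y" "y \<le> x"
    have e: "exp y = exp (y/2) * exp (y/2)" by (simp flip: exp_add)
    have "(g has_real_derivative (exp y - (exp (y/2) + y * (exp (y/2) / 2)))) (at y)"
      unfolding g_def by (auto intro!: derivative_eq_intros)
    moreover have "1 + y / 2 \<le> exp (y/2)" by (rule exp_ge_add_one_self)
    hence "exp (y/2) * (1 + y/2) \<le> exp (y/2) * exp (y/2)" by (intro mult_left_mono) auto
    hence "exp y - (exp (y/2) + y * (exp (y/2) / 2)) \<ge> 0" unfolding e by (simp add: algebra_simps)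
    ultimately show "\<exists>d. (g has_real_derivative d) (at y) \<and> 0 \<le> d" by blast
  qed
  thus ?thesis by (simp add: g_def)
qed

section \<open>Tangent and numerical bounds for the exponential function\<close>

lemma exp_tangent: "exp a * (1 + (x - a)) \<le> exp (x::real)"
proof -
  have "exp x = exp a * exp (x - a)" by (simp flip: exp_add)
  thus ?thesis using exp_ge_add_one_self[of "x - a"] by (simp add: mult_left_mono)
qed

text \<open>Source of the rational lower bounds below: the exponential is estimated at the small
  point \<open>x / n\<close> by a Taylor polynomial, and the estimate is raised to the power
  \<open>n\<close>.\<close>

lemma power_le_exp:
  fixes x y :: real
  assumes "0 < n" and "0 \<le> y" and "y \<le> exp (x / n)"
  shows "y ^ n \<le> exp x"
proof -
  have "y ^ n \<le> exp (x / n) ^ n"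
    using assms by (intro power_mono) auto
  thus ?thesis using assms by (simp flip: exp_of_nat_mult)
qed

text \<open>In the application \<open>exp (- G)\<close> is at least \<open>1 / 2\<close>, and
  \<open>25 / 36\<close> is a rational upper bound for \<open>ln 2\<close>. The cases split where
  \<open>u / 3 - 1 / 2\<close> changes sign.\<close>

lemma mult_exp_le_exp_add_two:
  fixes u G :: real
  assumes "0 \<le> u" and "0 \<le> G" and "G \<le> 25 / 36"
  shows "4 * u * exp (G * (u / 3 - 1 / 2)) \<le> exp u + 2"
proof (cases "u \<le> 3 / 2")
  case True
  have "exp (G * (u / 3 - 1 / 2)) \<le> 1"
    using True assms by (simp add: mult_nonneg_nonpos)
  hence "4 * u * exp (G * (u / 3 - 1 / 2)) \<le> 4 * u * 1"
    using assms by (intro mult_left_mono) auto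
  also have "4 * u \<le> exp u + 2"
  proof -
    \<comment> \<open>Since \<open>4 / 3 * u \<le> 2\<close> in this case,
      \<open>8 / 3 * u \<le> exp u\<close> suffices. The tangent at 1 is \<open>exp 1 * u\<close>,
      and \<open>8 / 3\<close> is just below \<open>exp 1\<close>.\<close>
    have "(65 / 64) ^ 64 \<le> exp (1 :: real)"
      using exp_ge_add_one_self[of "1 / 64 :: real"] by (intro power_le_exp) auto
    moreover have "8 / 3 \<le> (65 / 64 :: real) ^ 64" by (simp add: power_divide)
    ultimately have "8 / 3 * u \<le> exp 1 * u"
      using assms by (intro mult_right_mono) auto
    also have "\<dots> \<le> exp u" using exp_tangent[of 1 u] by simp
    finally show ?thesis using True by simp
  qed
  finally show ?thesis by simp
next
  \<comment> \<open>The left-hand side now increases with \<open>G\<close>. At \<open>G = 25 / 36\<close>, divided by \<open>exp y\<close>, the claim compares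
    a linear with a convex function of \<open>u\<close>; near the point of least slack the exponents are about
    \<open>141 / 100\<close> and \<open>- 2 / 5\<close>, where tangents are taken.\<close>
  case False
  \<comment> \<open>At \<open>G = 25 / 36\<close> the exponent \<open>G * (u / 3 - 1 / 2)\<close> is
    \<open>y - 25 / 72\<close>.\<close>
  define y where "y = 25 / 108 * u"
  have e1: "4085 / 1000 \<le> exp (141 / 100 :: real)"
  proof -
    have "1092 / 1000 \<le> exp (141 / 1600 :: real)"
      using exp_lower_Taylor_quadratic[of "141 / 1600"] by (simp add: power_divide)
    hence "(1092 / 1000) ^ 16 \<le> exp (141 / 100 :: real)" by (intro power_le_exp) auto
    moreover have "4085 / 1000 \<le> (1092 / 1000 :: real) ^ 16" by (simp add: power_divide)
    ultimately show ?thesis by linarith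
  qed
  have e2: "66 / 100 \<le> exp (- 2 / 5 :: real)"
  proof -
    have "(95 / 100) ^ 8 \<le> exp (- 2 / 5 :: real)"
      using exp_ge_add_one_self[of "- 1 / 20 :: real"] by (intro power_le_exp) auto
    moreover have "66 / 100 \<le> (95 / 100 :: real) ^ 8" by (simp add: power_divide)
    ultimately show ?thesis by linarith
  qed
  have e3: "4 * exp (- 25 / 72) \<le> (283 / 100 :: real)"
  proof -
    have "10905 / 10000 \<le> exp (25 / 288 :: real)"
      using exp_lower_Taylor_quadratic[of "25 / 288"] by (simp add: power_divide)
    hence "(10905 / 10000) ^ 4 \<le> exp (25 / 72 :: real)" by (intro power_le_exp) auto
    moreover have "400 / 283 \<le> (10905 / 10000 :: real) ^ 4" by (simp add: power_divide)
    ultimately have "400 / 283 \<le> exp (25 / 72 :: real)" by linarith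
    thus ?thesis by (simp add: exp_minus field_simps)
  qed
  have "G * (u / 3 - 1 / 2) \<le> 25 / 36 * (u / 3 - 1 / 2)"
    using False assms by (intro mult_right_mono) auto
  also have "\<dots> = - 25 / 72 + y" by (simp add: y_def)
  finally have "4 * u * exp (G * (u / 3 - 1 / 2)) \<le> 4 * u * exp (- 25 / 72 + y)"
    using assms by (intro mult_left_mono) auto
  also have "\<dots> = (4 * exp (- 25 / 72)) * u * exp y" unfolding exp_add by simp
  also have "\<dots> \<le> 283 / 100 * u * exp y"
    using assms e3 by (intro mult_right_mono) auto
  also have "283 / 100 * u \<le> exp (u - y) + 2 * exp (- y)"
  proof -
    have "4085 / 1000 * (1 + (u - y - 141 / 100)) \<le> exp (141 / 100) * (1 + (u - y - 141 / 100))"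
      using False e1 by (intro mult_right_mono) (auto simp: y_def)
    also have "\<dots> \<le> exp (u - y)" by (rule exp_tangent)
    finally have 1: "4085 / 1000 * (1 + (u - y - 141 / 100)) \<le> exp (u - y)" .
    \<comment> \<open>The numerical bound may be multiplied by the tangent factor only while that
      factor is nonnegative, that is for \<open>y \<le> 7 / 5\<close>; beyond that the left side is
      negative.\<close>
    have 2: "66 / 100 * (1 + (2 / 5 - y)) \<le> exp (- y)"
    proof (cases "y \<le> 7 / 5")
      case True
      hence "66 / 100 * (1 + (2 / 5 - y)) \<le> exp (- 2 / 5) * (1 + (2 / 5 - y))"
        using e2 by (intro mult_right_mono) auto
      also have "\<dots> \<le> exp (- y)" using exp_tangent[of "- 2 / 5" "- y"] by (simp add: add.commute)
      finally show ?thesis .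
    next
      case False
      hence "66 / 100 * (1 + (2 / 5 - y)) \<le> 0" by simp
      thus ?thesis by (meson exp_ge_zero order_trans)
    qed
    from 1 2 show ?thesis using assms(1) by (simp add: y_def)
  qed
  hence "283 / 100 * u * exp y \<le> (exp (u - y) + 2 * exp (- y)) * exp y"
    by (intro mult_right_mono) auto
  also have "\<dots> = exp u + 2"
    by (simp add: distrib_right flip: exp_add)
  finally show ?thesis .
qed

text \<open>
  With \<open>u = x\<^sup>2\<close> and \<open>G = y\<^sup>2\<close>, multiplication by \<open>exp (u + G)\<close> turns the claim into
  \<open>2 (cosh (2 x y) - 1) \<le> (exp G - 1) (exp u + 2)\<close>.
\<close>
lemma gaussian_second_difference_le:
  fixes x y :: real
  assumes "0 \<le> x" and "0 \<le> y" and "1 / 2 \<le> exp (- (y\<^sup>2))"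
  shows "exp (- ((x - y)\<^sup>2)) + exp (- ((x + y)\<^sup>2)) - 2 * exp (- (x\<^sup>2)) \<le> 1 - exp (- (y\<^sup>2))"
proof -
  define u G where "u = x\<^sup>2" and "G = y\<^sup>2"
  have nn: "0 \<le> u" "0 \<le> G" by (auto simp: u_def G_def)
  have "G \<le> 25 / 36"
  proof -
    have "exp G \<le> 2" using assms(3) by (simp add: G_def exp_minus field_simps)
    hence "G \<le> ln 2" by (simp add: ln_ge_iff)
    thus ?thesis using ln2_le_25_over_36 by linarith
  qed
  have "2 * (cosh (2 * x * y) - 1) \<le> (2 * x * y)\<^sup>2 * exp ((2 * x * y)\<^sup>2 / 12)"
    by (rule cosh_minus_one_le)
  \<comment> \<open>The exponent is \<open>G * u / 3 = G / 2 + G * (u / 3 - 1 / 2)\<close>. The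
    split produces one factor for \<open>mult_exp_half_le\<close> and one for
    \<open>mult_exp_le_exp_add_two\<close>.\<close>
  also have "\<dots> = (G * exp (G / 2)) * (4 * u * exp (G * (u / 3 - 1 / 2)))"
    by (simp add: u_def G_def power_mult_distrib algebra_simps flip: exp_add)
  also have "\<dots> \<le> (exp G - 1) * (exp u + 2)"
    using nn mult_exp_half_le[of G] mult_exp_le_exp_add_two[OF nn \<open>G \<le> 25 / 36\<close>]
    by (intro mult_mono) auto
  finally have "2 * (cosh (2 * x * y) - 1) * (exp (- u) * exp (- G))
      \<le> (exp G - 1) * (exp u + 2) * (exp (- u) * exp (- G))"
    by (intro mult_right_mono) auto
  also have "\<dots> = (1 - exp (- G)) * (1 + 2 * exp (- u))"
    by (simp add: exp_minus field_simps)
  finally have *: "2 * cosh (2 * x * y) * (exp (- u) * exp (- G)) - 2 * exp (- u) * exp (- G)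
      \<le> (1 - exp (- G)) * (1 + 2 * exp (- u))"
    by (simp add: algebra_simps)
  have "exp (- ((x - y)\<^sup>2)) + exp (- ((x + y)\<^sup>2)) = 2 * cosh (2 * x * y) * (exp (- u) * exp (- G))"
    by (simp add: cosh_def u_def G_def power2_eq_square algebra_simps flip: exp_add)
  with * show ?thesis unfolding u_def G_def by (simp add: algebra_simps)
qed

section \<open>Concentration on a subset of a product space\<close>

text \<open>An essential infimum: \<open>G\<close> is the pointwise infimum of a sequence in
  \<open>K\<close> whose integrals tend to the infimum \<open>I\<close>. It stays in
  \<open>K\<close> because the sequence is countable, and it attains \<open>I\<close>.\<close>

lemma (in prob_space) minimal_measurable_majorant:
  fixes L U :: "'a \<Rightarrow> real"
  assumes [measurable]: "U \<in> borel_measurable M"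
    and L: "\<And>x. x \<in> space M \<Longrightarrow> a \<le> L x" "\<And>x. x \<in> space M \<Longrightarrow> L x \<le> U x"
    and U: "\<And>x. x \<in> space M \<Longrightarrow> U x \<le> b"
  obtains G where "G \<in> borel_measurable M" "\<And>x. x \<in> space M \<Longrightarrow> L x \<le> G x"
    "\<And>x. x \<in> space M \<Longrightarrow> G x \<le> U x"
    "\<And>H. H \<in> borel_measurable M \<Longrightarrow> (\<And>x. x \<in> space M \<Longrightarrow> L x \<le> H x) \<Longrightarrow> AE x in M. G x \<le> H x"
proof -
  define K where "K = {G \<in> borel_measurable M. \<forall>x\<in>space M. L x \<le> G x \<and> G x \<le> U x}"
  have UK: "U \<in> K" using L by (auto simp: K_def)
  have bnd: "a \<le> G x" "G x \<le> b" if "G \<in> K" "x \<in> space M" for G x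
    using that L(1)[of x] U[of x] unfolding K_def by fastforce+
  have int: "integrable M G" if "G \<in> K" for G
    using that bnd[OF that]
    by (intro integrable_const_bound[where B = "\<bar>a\<bar> + \<bar>b\<bar>"] AE_I2) (force simp: K_def)+
  define I where "I = (INF G\<in>K. expectation G)"
  have bdd: "bdd_below (expectation ` K)"
  proof (rule bdd_belowI2)
    fix G assume "G \<in> K"
    thus "a \<le> expectation G"
      using int bnd by (intro integral_ge_const AE_I2) auto
  qed
  have "\<exists>G\<in>K. expectation G < I + 1 / Suc n" for n
    using cINF_less_iff[OF _ bdd, of "I + 1 / Suc n"] UK unfolding I_def by fastforce
  then obtain g where g: "\<And>n. g n \<in> K" "\<And>n. expectation (g n) < I + 1 / Suc n"
    by metis
  define G where "G x = (INF n. g n x)" for x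
  have bb: "bdd_below (range (\<lambda>n. g n x))" if "x \<in> space M" for x
    using bnd(1)[OF g(1) that] by (intro bdd_belowI2)
  have [measurable]: "g n \<in> borel_measurable M" for n using g(1) by (auto simp: K_def)
  have Gle: "G x \<le> g n x" if "x \<in> space M" for x n
    unfolding G_def using bb[OF that] by (intro cINF_lower) auto
  have "G \<in> borel_measurable M" unfolding G_def by measurable
  moreover have "L x \<le> G x" if "x \<in> space M" for x
    unfolding G_def using g(1) that by (intro cINF_greatest) (auto simp: K_def)
  moreover have "G x \<le> U x" if "x \<in> space M" for x
    using Gle[OF that, of 0] g(1)[of 0] that by (force simp: K_def)
  ultimately have GK: "G \<in> K" by (auto simp: K_def)
  have "expectation G \<le> expectation (g n)" for n
    using Gle by (intro integral_mono int GK g(1))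
  hence "expectation G \<le> I + 1 / Suc n" for n
    using g(2)[of n] by (meson less_imp_le order_trans)
  moreover have "(\<lambda>n. I + 1 / Suc n) \<longlonglongrightarrow> I + 0"
    by (intro tendsto_add tendsto_const LIMSEQ_Suc lim_const_over_n)
  ultimately have GI: "expectation G \<le> I"
    by (intro LIMSEQ_le_const) auto
  show ?thesis
  proof (rule that[of G])
    fix H :: "'a \<Rightarrow> real"
    assume H: "H \<in> borel_measurable M" "\<And>x. x \<in> space M \<Longrightarrow> L x \<le> H x"
    \<comment> \<open>\<open>H\<close> itself may exceed \<open>U\<close>, but the minimum lies in
      \<open>K\<close>. Its integral is therefore at least \<open>I\<close>, which forces it to
      equal \<open>G\<close> almost everywhere.\<close>
    define m where "m x = min (G x) (H x)" for x
    have mK: "m \<in> K" using GK H unfolding K_def m_def by (auto intro!: borel_measurable_min)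
    have "I \<le> expectation m" unfolding I_def by (rule cINF_lower[OF bdd mK])
    with GI have "expectation (\<lambda>x. G x - m x) \<le> 0"
      by (subst Bochner_Integration.integral_diff) (auto intro: int GK mK)
    moreover have "0 \<le> expectation (\<lambda>x. G x - m x)"
      by (intro integral_nonneg_AE) (auto simp: m_def)
    ultimately have "expectation (\<lambda>x. G x - m x) = 0" by simp
    hence "AE x in M. G x - m x = 0"
      using integral_nonneg_eq_0_iff_AE[OF Bochner_Integration.integrable_diff[OF int[OF GK] int[OF mK]]]
      by (simp add: m_def)
    thus "AE x in M. G x \<le> H x" by eventually_elim (auto simp: m_def)
  qed (use GK in \<open>auto simp: K_def\<close>)
qed

text \<open>Almost every point lies in \<open>S\<close>. With \<open>a\<close> the infimum of
  \<open>g\<close> on \<open>S\<close>, almost all values of \<open>g\<close> lie in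
  \<open>[a, a + c]\<close>, so Hoeffding's lemma applies.\<close>

lemma (in prob_space) hoeffding_AE_oscillation:
  fixes g :: "'a \<Rightarrow> real"
  assumes [measurable]: "g \<in> borel_measurable M"
    and B: "\<And>x. x \<in> space M \<Longrightarrow> \<bar>g x\<bar> \<le> B"
    and osc: "AE y in M. AE x in M. g x \<le> c + g y"
  shows "expectation (\<lambda>x. exp (l * (g x - expectation g))) \<le> exp (l\<^sup>2 * c\<^sup>2 / 8)"
proof -
  define S where "S = {y \<in> space M. AE x in M. g x \<le> c + g y}"
  define a where "a = (INF y\<in>S. g y)"
  have AES: "AE y in M. y \<in> S" using osc AE_space by eventually_elim (auto simp: S_def)
  have "S \<noteq> {}"
  proof
    assume "S = {}"
    with AES have "AE y in M. False" by simp
    thus False by simp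
  qed
  have bdd: "bdd_below (g ` S)"
    using B by (intro bdd_belowI2[of _ "- B"]) (fastforce simp: S_def abs_le_iff)
  have lo: "AE x in M. a \<le> g x"
    using AES by eventually_elim (auto simp: a_def intro!: cINF_lower[OF bdd])
  \<comment> \<open>The infimum \<open>a\<close> need not be attained on \<open>S\<close>, so the
    upper bound is reached along \<open>1 / Suc n\<close>, at the cost of countably many null
    sets.\<close>
  have "AE x in M. g x \<le> c + a + 1 / Suc n" for n
  proof -
    obtain y where y: "y \<in> S" "g y < a + 1 / Suc n"
      using cINF_less_iff[OF \<open>S \<noteq> {}\<close> bdd, of "a + 1 / Suc n"] unfolding a_def by fastforce
    from y(1) have "AE x in M. g x \<le> c + g y" by (simp add: S_def)
    thus ?thesis by eventually_elim (use y(2) in auto)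
  qed
  hence "AE x in M. \<forall>n. g x \<le> c + a + 1 / Suc n" by (simp add: AE_all_countable)
  hence hi: "AE x in M. g x \<le> a + c"
  proof eventually_elim
    case (elim x)
    have "(\<lambda>n. c + a + 1 / Suc n) \<longlonglongrightarrow> c + a + 0"
      by (intro tendsto_add tendsto_const LIMSEQ_Suc lim_const_over_n)
    thus ?case using elim LIMSEQ_le_const[of _ "c + a + 0" "g x"] by (auto simp: add.commute)
  qed
  have pos: "expectation (\<lambda>x. exp (k * (h x - expectation h))) \<le> exp (k\<^sup>2 * c\<^sup>2 / 8)"
    if k: "k > 0" and [measurable]: "h \<in> borel_measurable M" and h: "AE x in M. h x \<in> {d..d + c}"
    for k d h
  proof -
    interpret h: interval_bounded_random_variable M h d "d + c"
      using h by unfold_locales auto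
    from h.Hoeffdings_lemma_nn_integral[OF k]
    have "(\<integral>\<^sup>+x. ennreal (exp (k * (h x - expectation h))) \<partial>M) \<le> ennreal (exp (k\<^sup>2 * c\<^sup>2 / 8))"
      by simp
    thus ?thesis by (subst integral_eq_nn_integral) (auto intro!: enn2real_leI)
  qed
  \<comment> \<open>Hoeffding's lemma is for positive parameters. A negative \<open>l\<close> is
    handled through \<open>- g\<close>, whose values lie in an interval of the same length.\<close>
  consider "l > 0" | "l = 0" | "l < 0" by linarith
  thus ?thesis
  proof cases
    case 1
    have "AE x in M. g x \<in> {a..a + c}" using lo hi by eventually_elim auto
    with 1 show ?thesis using pos by simp
  next
    case 3
    have "AE x in M. - g x \<in> {- (a + c).. - (a + c) + c}" using lo hi by eventually_elim auto
    with 3 pos[of "- l" "\<lambda>x. - g x" "- (a + c)"] show ?thesis by (simp add: right_diff_distrib)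
  qed (simp add: prob_space)
qed

text \<open>By Tonelli almost every section of a null set is null. The argument runs on a measurable
  null set \<open>N\<close> covering the exceptions, since \<open>Q\<close> may fail to be
  measurable.\<close>

lemma (in product_sigma_finite) AE_PiM_insert:
  assumes "finite I" "i \<notin> I" and "AE z in Pi\<^sub>M (insert i I) M. Q z"
  shows "AE x in Pi\<^sub>M I M. AE y in M i. Q (x(i := y))"
proof -
  let ?P = "Pi\<^sub>M (insert i I) M"
  obtain N where N: "N \<in> sets ?P" "emeasure ?P N = 0" "{z \<in> space ?P. \<not> Q z} \<subseteq> N"
    using assms(3) unfolding eventually_ae_filter by auto
  have upd: "(\<lambda>y. x(i := y)) \<in> measurable (M i) ?P" if "x \<in> space (Pi\<^sub>M I M)" for x
    using that assms(2) by (rule measurable_component_update)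
  have [measurable]: "(\<lambda>(x, y). indicator N (x(i := y)) :: ennreal) \<in> borel_measurable (Pi\<^sub>M I M \<Otimes>\<^sub>M M i)"
    using measurable_compose[OF measurable_add_dim borel_measurable_indicator[OF N(1)]]
    by (simp add: case_prod_beta')
  have "(\<integral>\<^sup>+x. \<integral>\<^sup>+y. indicator N (x(i := y)) \<partial>M i \<partial>Pi\<^sub>M I M) = 0"
    using N product_nn_integral_insert[OF assms(1,2), of "indicator N"] by simp
  hence "AE x in Pi\<^sub>M I M. (\<integral>\<^sup>+y. indicator N (x(i := y)) \<partial>M i) = (0 :: ennreal)"
    using sigma_finite_measures by (subst (asm) nn_integral_0_iff_AE) auto
  thus ?thesis using AE_space
  proof eventually_elim
    case (elim x)
    have "AE y in M i. indicator N (x(i := y)) = (0 :: ennreal)"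
      using elim N(1) measurable_compose[OF upd borel_measurable_indicator]
      by (subst nn_integral_0_iff_AE[symmetric]) auto
    thus ?case using AE_space
    proof eventually_elim
      case (elim y)
      have "x(i := y) \<in> space ?P"
        using measurable_space[OF upd] \<open>x \<in> _\<close> \<open>y \<in> _\<close> by blast
      thus ?case using elim N(3) by (auto simp: indicator_def split: if_splits)
    qed
  qed
qed

text \<open>Induction on the coordinates. Integrating out \<open>j\<close> gives \<open>H\<close>,
  to which the induction hypothesis applies; for fixed other coordinates, Hoeffding's lemma in
  coordinate \<open>j\<close> contributes one factor
  \<open>exp (l\<^sup>2 * c\<^sup>2 / 8)\<close>.\<close>

lemma mcdiarmid_AE:
  fixes G :: "('i \<Rightarrow> 'a) \<Rightarrow> real"
  assumes "prob_space \<mu>" and "finite I"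
    and "G \<in> borel_measurable (Pi\<^sub>M I (\<lambda>_. \<mu>))"
    and "\<And>x. x \<in> space (Pi\<^sub>M I (\<lambda>_. \<mu>)) \<Longrightarrow> \<bar>G x\<bar> \<le> B"
    and "\<And>k y. k \<in> I \<Longrightarrow> y \<in> space \<mu> \<Longrightarrow> AE x in Pi\<^sub>M I (\<lambda>_. \<mu>). G x \<le> c + G (x(k := y))"
  shows "(\<integral>x. exp (l * (G x - (\<integral>x. G x \<partial>Pi\<^sub>M I (\<lambda>_. \<mu>)))) \<partial>Pi\<^sub>M I (\<lambda>_. \<mu>))
           \<le> exp (l\<^sup>2 * c\<^sup>2 * real (card I) / 8)"
  using assms(2-5)
proof (induction I arbitrary: G rule: finite_induct)
  case empty
  show ?case
    by (simp add: PiM_empty lebesgue_integral_count_space_finite)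
next
  case (insert j I)
  interpret \<mu>: prob_space \<mu> by fact
  interpret prod: product_prob_space "\<lambda>_. \<mu>" UNIV by unfold_locales
  let ?P = "Pi\<^sub>M I (\<lambda>_. \<mu>)" and ?Q = "Pi\<^sub>M (insert j I) (\<lambda>_. \<mu>)"
  interpret PI: prob_space ?P by (intro prob_space_PiM assms)
  interpret QI: prob_space ?Q by (intro prob_space_PiM assms)
  interpret prodmu: pair_sigma_finite ?P \<mu> ..
  have G[measurable]: "G \<in> borel_measurable ?Q" by fact
  have upd: "x(j := y) \<in> space ?Q" if "x \<in> space ?P" "y \<in> space \<mu>" for x y
    using that by (auto simp: space_PiM PiE_def extensional_def)
  have GB: "\<bar>G (x(j := y))\<bar> \<le> B" if "x \<in> space ?P" "y \<in> space \<mu>" for x y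
    using insert.prems(2)[OF upd[OF that]] .
  have GQ[measurable]: "(\<lambda>(x, y). G (x(j := y))) \<in> borel_measurable (?P \<Otimes>\<^sub>M \<mu>)"
    using measurable_compose[OF measurable_add_dim G] by (simp add: case_prod_beta')
  have Gx[measurable]: "(\<lambda>y. G (x(j := y))) \<in> borel_measurable \<mu>" if "x \<in> space ?P" for x
    using measurable_compose[OF measurable_component_update[OF that insert.hyps(2)] G] .
  define H where "H x = (\<integral>y. G (x(j := y)) \<partial>\<mu>)" for x
  have H[measurable]: "H \<in> borel_measurable ?P"
    unfolding H_def by measurable
  have intG: "integrable \<mu> (\<lambda>y. G (x(j := y)))" if "x \<in> space ?P" for x
    using GB[OF that] Gx[OF that] by (intro \<mu>.integrable_const_bound[where B = B]) auto
  have HB: "\<bar>H x\<bar> \<le> B" if "x \<in> space ?P" for x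
  proof -
    have "\<bar>H x\<bar> \<le> (\<integral>y. \<bar>G (x(j := y))\<bar> \<partial>\<mu>)" unfolding H_def by (rule integral_abs_bound)
    also have "\<dots> \<le> B"
      using GB[OF that] intG[OF that] by (intro \<mu>.integral_le_const AE_I2) auto
    finally show ?thesis .
  qed
  \<comment> \<open>As \<open>k\<close> differs from \<open>j\<close>, the two updates commute, and
    the bound for \<open>G\<close> can be integrated over coordinate \<open>j\<close>.\<close>
  have Hk: "AE x in ?P. H x \<le> c + H (x(k := y))" if k: "k \<in> I" and y: "y \<in> space \<mu>" for k y
  proof -
    have "AE z in ?Q. G z \<le> c + G (z(k := y))" using insert.prems(3)[OF insertI2[OF k] y] .
    hence "AE x in ?P. AE y' in \<mu>. G (x(j := y')) \<le> c + G ((x(j := y'))(k := y))"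
      using prod.AE_PiM_insert[OF insert.hyps] by blast
    thus ?thesis using AE_space
    proof eventually_elim
      case (elim x)
      have xk: "x(k := y) \<in> space ?P"
        using elim k y by (auto simp: space_PiM PiE_def extensional_def)
      have jk: "(x(j := y'))(k := y) = (x(k := y))(j := y')" for y'
        using k insert.hyps by (intro fun_upd_twist) auto
      have "H x \<le> (\<integral>y'. c + G ((x(k := y))(j := y')) \<partial>\<mu>)"
        unfolding H_def using elim intG[OF xk] intG[OF elim(2)]
        by (intro integral_mono_AE) (auto simp: jk)
      thus ?case using intG[OF xk] by (simp add: H_def \<mu>.prob_space)
    qed
  qed
  have osc: "AE x in ?P. AE y' in \<mu>. AE y in \<mu>. G (x(j := y)) \<le> c + G (x(j := y'))"
  proof -
    \<comment> \<open>The hypothesis provides the quantifier over \<open>y'\<close> outermost,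
      whereas Hoeffding needs it inside the one over \<open>x\<close>. The swap requires a
      measurable set; \<open>ennreal\<close> cuts negative values to 0, so the inner condition
      becomes the vanishing of a measurable integral.\<close>
    have eq: "(AE y in \<mu>. G (x(j := y)) \<le> c + G (x(j := y')))
        \<longleftrightarrow> (\<integral>\<^sup>+y. ennreal (G (x(j := y)) - (c + G (x(j := y')))) \<partial>\<mu>) = 0"
      if "x \<in> space ?P" for x y'
      using Gx[OF that] by (subst nn_integral_0_iff_AE) (auto simp: ennreal_eq_0_iff)
    have [measurable]: "(\<lambda>p. G ((fst (fst p))(j := snd p))) \<in> borel_measurable ((?P \<Otimes>\<^sub>M \<mu>) \<Otimes>\<^sub>M \<mu>)"
    proof -
      have "(\<lambda>p. (fst (fst p), snd p)) \<in> measurable ((?P \<Otimes>\<^sub>M \<mu>) \<Otimes>\<^sub>M \<mu>) (?P \<Otimes>\<^sub>M \<mu>)" by measurable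
      from measurable_compose[OF this GQ] show ?thesis by simp
    qed
    have [measurable]: "(\<lambda>p. G ((fst (fst p))(j := snd (fst p)))) \<in> borel_measurable ((?P \<Otimes>\<^sub>M \<mu>) \<Otimes>\<^sub>M \<mu>)"
      using measurable_compose[OF measurable_fst GQ] by (simp add: case_prod_beta')
    let ?D = "\<lambda>p. \<integral>\<^sup>+y. ennreal (G ((fst p)(j := y)) - (c + G ((fst p)(j := snd p)))) \<partial>\<mu>"
    have "(\<lambda>(p, y). ennreal (G ((fst p)(j := y)) - (c + G ((fst p)(j := snd p)))))
        \<in> borel_measurable ((?P \<Otimes>\<^sub>M \<mu>) \<Otimes>\<^sub>M \<mu>)"
      unfolding case_prod_beta' by measurable
    hence [measurable]: "?D \<in> borel_measurable (?P \<Otimes>\<^sub>M \<mu>)"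
      by (rule \<mu>.borel_measurable_nn_integral)
    have "{p \<in> space (?P \<Otimes>\<^sub>M \<mu>). AE y in \<mu>. G ((fst p)(j := y)) \<le> c + G ((fst p)(j := snd p))}
        = {p \<in> space (?P \<Otimes>\<^sub>M \<mu>). ?D p = 0}"
      using eq by (auto simp: space_pair_measure)
    also have "\<dots> \<in> sets (?P \<Otimes>\<^sub>M \<mu>)" by measurable
    finally have meas: "{p \<in> space (?P \<Otimes>\<^sub>M \<mu>). AE y in \<mu>. G ((fst p)(j := y)) \<le> c + G ((fst p)(j := snd p))}
        \<in> sets (?P \<Otimes>\<^sub>M \<mu>)" .
    have "AE x in ?P. AE y in \<mu>. G (x(j := y)) \<le> c + G (x(j := y'))" if "y' \<in> space \<mu>" for y'
      using prod.AE_PiM_insert[OF insert.hyps insert.prems(3)[OF insertI1 that]] by (simp only: fun_upd_upd)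
    hence "AE y' in \<mu>. AE x in ?P. AE y in \<mu>. G (x(j := y)) \<le> c + G (x(j := y'))"
      by (rule AE_I2)
    thus ?thesis using prodmu.AE_commute[OF meas] by blast
  qed
  have intGQ: "integrable ?Q G"
    using insert.prems(2) by (intro QI.integrable_const_bound[where B = B]) auto
  define E where "E = (\<integral>x. G x \<partial>?Q)"
  \<comment> \<open>\<open>G\<close> and \<open>H\<close> share the mean \<open>E\<close>. The
    exponent thus splits into \<open>H x - E\<close>, for the induction hypothesis, and the
    deviation of \<open>G\<close> from \<open>H x\<close>, for Hoeffding.\<close>
  have E: "E = (\<integral>x. H x \<partial>?P)"
    unfolding E_def H_def by (rule prod.product_integral_insert[OF insert.hyps intGQ])
  have bexp: "exp (l * (v - E)) \<le> exp (\<bar>l\<bar> * (B + \<bar>E\<bar>))" if "\<bar>v\<bar> \<le> B" for v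
  proof -
    have "l * (v - E) \<le> \<bar>l\<bar> * \<bar>v - E\<bar>" by (metis abs_ge_self abs_mult)
    also have "\<dots> \<le> \<bar>l\<bar> * (B + \<bar>E\<bar>)" using that by (intro mult_left_mono) auto
    finally show ?thesis by simp
  qed
  have intexp: "integrable ?Q (\<lambda>x. exp (l * (G x - E)))"
    using insert.prems(2) bexp by (intro QI.integrable_const_bound[where B = "exp (\<bar>l\<bar> * (B + \<bar>E\<bar>))"]) auto
  have intexpH: "integrable ?P (\<lambda>x. exp (l * (H x - E)))"
    using HB bexp by (intro PI.integrable_const_bound[where B = "exp (\<bar>l\<bar> * (B + \<bar>E\<bar>))"]) auto
  have intexpx: "integrable \<mu> (\<lambda>y. exp (l * (G (x(j := y)) - E)))" if "x \<in> space ?P" for x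
    using GB[OF that] bexp Gx[OF that]
    by (intro \<mu>.integrable_const_bound[where B = "exp (\<bar>l\<bar> * (B + \<bar>E\<bar>))"]) auto
  have "(\<integral>x. exp (l * (G x - E)) \<partial>?Q) = (\<integral>x. \<integral>y. exp (l * (G (x(j := y)) - E)) \<partial>\<mu> \<partial>?P)"
    by (rule prod.product_integral_insert[OF insert.hyps intexp])
  also have "\<dots> \<le> (\<integral>x. exp (l * (H x - E)) * exp (l\<^sup>2 * c\<^sup>2 / 8) \<partial>?P)"
  proof (rule integral_mono_AE)
    show "integrable ?P (\<lambda>x. \<integral>y. exp (l * (G (x(j := y)) - E)) \<partial>\<mu>)"
    proof (rule PI.integrable_const_bound[where B = "exp (\<bar>l\<bar> * (B + \<bar>E\<bar>))"])
      show "AE x in ?P. norm (\<integral>y. exp (l * (G (x(j := y)) - E)) \<partial>\<mu>) \<le> exp (\<bar>l\<bar> * (B + \<bar>E\<bar>))"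
      proof (rule AE_I2)
        fix x assume x: "x \<in> space ?P"
        have "0 \<le> (\<integral>y. exp (l * (G (x(j := y)) - E)) \<partial>\<mu>)" by simp
        moreover have "(\<integral>y. exp (l * (G (x(j := y)) - E)) \<partial>\<mu>) \<le> exp (\<bar>l\<bar> * (B + \<bar>E\<bar>))"
          using intexpx[OF x] bexp GB[OF x] by (intro \<mu>.integral_le_const AE_I2) auto
        ultimately show "norm (\<integral>y. exp (l * (G (x(j := y)) - E)) \<partial>\<mu>) \<le> exp (\<bar>l\<bar> * (B + \<bar>E\<bar>))"
          by simp
      qed
    qed measurable
    show "AE x in ?P. (\<integral>y. exp (l * (G (x(j := y)) - E)) \<partial>\<mu>) \<le> exp (l * (H x - E)) * exp (l\<^sup>2 * c\<^sup>2 / 8)"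
      using osc AE_space
    proof eventually_elim
      case (elim x)
      have "(\<integral>y. exp (l * (G (x(j := y)) - E)) \<partial>\<mu>)
          = (\<integral>y. exp (l * (H x - E)) * exp (l * (G (x(j := y)) - H x)) \<partial>\<mu>)"
        by (intro Bochner_Integration.integral_cong) (auto simp: algebra_simps simp flip: exp_add)
      also have "\<dots> = exp (l * (H x - E)) * (\<integral>y. exp (l * (G (x(j := y)) - H x)) \<partial>\<mu>)"
        by simp
      also have "\<dots> \<le> exp (l * (H x - E)) * exp (l\<^sup>2 * c\<^sup>2 / 8)"
        unfolding H_def using elim GB
        by (intro mult_left_mono \<mu>.hoeffding_AE_oscillation[where B = B] Gx) auto
      finally show ?case .
    qed
  qed (use intexpH in auto)
  also have "\<dots> = (\<integral>x. exp (l * (H x - E)) \<partial>?P) * exp (l\<^sup>2 * c\<^sup>2 / 8)" by simp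
  also have "\<dots> \<le> exp (l\<^sup>2 * c\<^sup>2 * real (card I) / 8) * exp (l\<^sup>2 * c\<^sup>2 / 8)"
    unfolding E by (intro mult_right_mono insert.IH H HB Hk) auto
  also have "\<dots> = exp (l\<^sup>2 * c\<^sup>2 * real (card (insert j I)) / 8)"
    using insert.hyps by (simp add: field_simps flip: exp_add)
  finally show ?case unfolding E_def .
qed

text \<open>\<open>\<delta>\<close> is the distance of the conditional mean \<open>m\<close> from
  the mean of the majorant. One \<open>\<delta>\<close> enters both tails with opposite signs, so
  its effects can partly cancel in their sum.\<close>

lemma concentration_on_subset:
  fixes F :: "('i \<Rightarrow> 'a) \<Rightarrow> real" and c :: real and I :: "'i set" and \<mu> :: "'a measure" and \<Xi> :: "('i \<Rightarrow> 'a) set"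
  defines "P \<equiv> Pi\<^sub>M I (\<lambda>_. \<mu>)"
  defines "p \<equiv> measure P \<Xi>"
  defines "m \<equiv> (\<integral>z. indicator \<Xi> z * F z \<partial>P) / p"
  defines "K \<equiv> c\<^sup>2 * real (card I)"
  assumes "prob_space \<mu>" and I: "finite I" "I \<noteq> {}" and "0 < c"
    and F[measurable]: "F \<in> borel_measurable P" and \<Xi>[measurable]: "\<Xi> \<in> sets P" and "0 < p"
    and lip: "\<And>z z'. z \<in> \<Xi> \<Longrightarrow> z' \<in> \<Xi> \<Longrightarrow> F z - F z' \<le> c * real (card {j \<in> I. z j \<noteq> z' j})"
  obtains \<delta> where "\<bar>\<delta>\<bar> \<le> (1 - p) * real (card I) * c"
    and "p \<le> exp (- (2 * \<delta>\<^sup>2 / K))"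
    and "\<And>t. 0 \<le> t + \<delta> \<Longrightarrow> measure P {z \<in> \<Xi>. m + t < F z} \<le> exp (- (2 * (t + \<delta>)\<^sup>2 / K))"
    and "\<And>t. 0 \<le> t - \<delta> \<Longrightarrow> measure P {z \<in> \<Xi>. F z < m - t} \<le> exp (- (2 * (t - \<delta>)\<^sup>2 / K))"
proof -
  interpret prob_space P unfolding P_def by (intro prob_space_PiM assms)
  define N where "N = real (card I)"
  define d where "d z z' = real (card {j \<in> I. z j \<noteq> z' j})" for z z' :: "'i \<Rightarrow> 'a"
  have dN: "d z z' \<le> N" for z z'
    unfolding d_def N_def using I by (intro of_nat_mono card_mono) auto
  have cd: "c * d z z' \<le> c * N" "0 \<le> c * d z z'" for z z'
    using dN \<open>0 < c\<close> by (auto intro!: mult_left_mono mult_nonneg_nonneg simp: d_def)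
  have lip': "F z \<le> F z' + c * d z z'" if "z \<in> \<Xi>" "z' \<in> \<Xi>" for z z'
    using lip[OF that] by (simp add: d_def)
  have K: "K > 0" using I \<open>0 < c\<close> by (simp add: K_def card_gt_0_iff)
  have "\<Xi> \<noteq> {}" using \<open>0 < p\<close> by (auto simp: p_def)
  then obtain z0 where z0: "z0 \<in> \<Xi>" by blast
  \<comment> \<open>Hamming distances are at most \<open>N\<close>, so all values of
    \<open>F\<close> on \<open>\<Xi>\<close> lie in \<open>[lo, lo + c * N]\<close>.\<close>
  define lo where "lo = (INF z\<in>\<Xi>. F z)"
  have bddF: "bdd_below (F ` \<Xi>)"
  proof (rule bdd_belowI2)
    fix z assume "z \<in> \<Xi>"
    with lip'[OF z0 this] cd(1)[of z0 z] show "F z0 - c * N \<le> F z" by simp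
  qed
  have lo: "lo \<le> F z" if "z \<in> \<Xi>" for z
    unfolding lo_def using that by (rule cINF_lower[OF bddF])
  have lo_greatest: "a \<le> lo" if "\<And>z. z \<in> \<Xi> \<Longrightarrow> a \<le> F z" for a
    unfolding lo_def using \<open>\<Xi> \<noteq> {}\<close> that by (intro cINF_greatest)
  have hi: "F z \<le> lo + c * N" if "z \<in> \<Xi>" for z
  proof -
    have "F z - c * N \<le> F z'" if z': "z' \<in> \<Xi>" for z'
      using lip'[OF \<open>z \<in> \<Xi>\<close> z'] cd(1)[of z z'] by simp
    from lo_greatest[OF this] show ?thesis by simp
  qed
  define L where "L z = (INF z'\<in>\<Xi>. F z' + c * d z z')" for z
  have L_lower: "L z \<le> F z' + c * d z z'" if "z' \<in> \<Xi>" for z z'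
    unfolding L_def
  proof (rule cINF_lower[OF _ that])
    show "bdd_below ((\<lambda>z'. F z' + c * d z z') ` \<Xi>)"
      by (rule bdd_belowI2[of _ lo]) (use lo cd in \<open>fastforce intro: add_increasing2\<close>)
  qed
  have L_greatest: "a \<le> L z" if "\<And>z'. z' \<in> \<Xi> \<Longrightarrow> a \<le> F z' + c * d z z'" for a z
    unfolding L_def using \<open>\<Xi> \<noteq> {}\<close> that by (intro cINF_greatest)
  \<comment> \<open>A measurable upper barrier that equals \<open>F\<close> on \<open>\<Xi>\<close>.
    As \<open>L\<close> is at least \<open>F\<close> there, every function between \<open>L\<close>
    and \<open>U\<close> agrees with \<open>F\<close> on \<open>\<Xi>\<close>.\<close>
  define U where "U z = (if z \<in> \<Xi> then F z else lo + c * N)" for z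
  have lo_L: "lo \<le> L z" for z
    using lo cd(2) by (intro L_greatest) (fastforce intro: add_increasing2)
  have L_U: "L z \<le> U z" for z
  proof (cases "z \<in> \<Xi>")
    case True
    have "d z z = 0" by (simp add: d_def)
    with True L_lower[OF True, of z] show ?thesis by (simp add: U_def)
  next
    case False
    have "L z - c * N \<le> lo"
    proof (rule lo_greatest)
      fix z' assume "z' \<in> \<Xi>"
      from L_lower[OF this, of z] cd(1)[of z z'] show "L z - c * N \<le> F z'" by simp
    qed
    with False show ?thesis by (simp add: U_def)
  qed
  have L_F: "F z \<le> L z" if "z \<in> \<Xi>" for z
    using lip'[OF that] by (rule L_greatest)
  have L_lip: "L x \<le> c + L (x(k := y))" for x k y
  proof -
    have "L x - c \<le> L (x(k := y))"
    proof (rule L_greatest)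
      fix z' assume z': "z' \<in> \<Xi>"
      have "card {j \<in> I. x j \<noteq> z' j} \<le> card (insert k {j \<in> I. (x(k := y)) j \<noteq> z' j})"
        using I by (intro card_mono) auto
      also have "\<dots> \<le> Suc (card {j \<in> I. (x(k := y)) j \<noteq> z' j})" by (rule card_insert_le_m1) auto
      finally have "d x z' \<le> d (x(k := y)) z' + 1" by (simp add: d_def)
      hence "c * d x z' \<le> c * (d (x(k := y)) z' + 1)" using \<open>0 < c\<close> by simp
      with L_lower[OF z', of x] show "L x - c \<le> F z' + c * d (x(k := y)) z'"
        by (simp add: algebra_simps)
    qed
    thus ?thesis by simp
  qed
  have [measurable]: "U \<in> borel_measurable P" unfolding U_def by measurable
  have U_hi: "U z \<le> lo + c * N" for z using hi by (simp add: U_def)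
  obtain G where G[measurable]: "G \<in> borel_measurable P"
    and LG: "\<And>x. x \<in> space P \<Longrightarrow> L x \<le> G x" and GU: "\<And>x. x \<in> space P \<Longrightarrow> G x \<le> U x"
    and Gmin: "\<And>H. H \<in> borel_measurable P \<Longrightarrow> (\<And>x. x \<in> space P \<Longrightarrow> L x \<le> H x) \<Longrightarrow> AE x in P. G x \<le> H x"
  proof (rule minimal_measurable_majorant[OF \<open>U \<in> borel_measurable P\<close> lo_L L_U U_hi], goal_cases)
    case (1 G)
    show ?case by (rule that[of G]) (fact 1)+
  qed
  have \<Xi>_space: "z \<in> space P" if "z \<in> \<Xi>" for z using that sets.sets_into_space[OF \<Xi>] by blast
  have GF: "G z = F z" if "z \<in> \<Xi>" for z
    using LG[OF \<Xi>_space[OF that]] GU[OF \<Xi>_space[OF that]] L_F[OF that] that by (simp add: U_def)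
  have G_lo: "lo \<le> G z" and G_hi: "G z \<le> lo + c * N" if "z \<in> space P" for z
    using LG[OF that] lo_L[of z] GU[OF that] U_hi[of z] by linarith+
  \<comment> \<open>The function \<open>c + G (x(k := y))\<close> of \<open>x\<close> is itself a
    measurable majorant of \<open>L\<close>, so minimality applies to it.\<close>
  have G_AE: "AE x in P. G x \<le> c + G (x(k := y))" if "k \<in> I" "y \<in> space \<mu>" for k y
  proof (rule Gmin)
    have upd: "(\<lambda>x. x(k := y)) \<in> measurable P P"
      unfolding P_def using that by (intro measurable_fun_upd[where J = I]) auto
    from measurable_compose[OF this G] show "(\<lambda>x. c + G (x(k := y))) \<in> borel_measurable P" by simp
    show "L x \<le> c + G (x(k := y))" if "x \<in> space P" for x
      using L_lip[of x k y] LG[OF measurable_space[OF upd that]] by linarith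
  qed
  have GB: "\<bar>G x\<bar> \<le> \<bar>lo\<bar> + \<bar>lo + c * N\<bar>" if "x \<in> space P" for x
    using G_lo[OF that] G_hi[OF that] by linarith
  define \<delta> where "\<delta> = m - expectation G"
  have mgf: "expectation (\<lambda>x. exp (l * (G x - expectation G))) \<le> exp (l\<^sup>2 * K / 8)" for l
    using mcdiarmid_AE[OF assms(5) I(1) G[unfolded P_def] GB[unfolded P_def] G_AE[unfolded P_def], of l]
    by (simp add: K_def P_def mult.assoc)
  have bexp: "exp (l * (G x - a)) \<le> exp (\<bar>l\<bar> * (\<bar>lo\<bar> + \<bar>lo + c * N\<bar> + \<bar>a\<bar>))" if "x \<in> space P" for l a x
  proof -
    have "l * (G x - a) \<le> \<bar>l\<bar> * \<bar>G x - a\<bar>" by (metis abs_ge_self abs_mult)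
    also have "\<dots> \<le> \<bar>l\<bar> * (\<bar>lo\<bar> + \<bar>lo + c * N\<bar> + \<bar>a\<bar>)"
      using GB[OF that] by (intro mult_left_mono) auto
    finally show ?thesis by simp
  qed
  have intexp: "integrable P (\<lambda>x. exp (l * (G x - a)))" for l a
    using bexp
    by (intro integrable_const_bound[where B = "exp (\<bar>l\<bar> * (\<bar>lo\<bar> + \<bar>lo + c * N\<bar> + \<bar>a\<bar>))"]) auto
  have intG: "integrable P G" 
    using GB by (intro integrable_const_bound[where B = "\<bar>lo\<bar> + \<bar>lo + c * N\<bar>"]) auto
  have int\<Xi>: "integrable P (indicator \<Xi> :: _ \<Rightarrow> real)" by (simp add: emeasure_eq_measure)
  have int\<Xi>G: "integrable P (\<lambda>x. indicator \<Xi> x * G x)"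
    using integrable_mult_indicator[OF \<Xi> intG] by simp
  have m: "expectation (\<lambda>x. indicator \<Xi> x * G x) = p * m"
  proof -
    have "expectation (\<lambda>x. indicator \<Xi> x * G x) = expectation (\<lambda>x. indicator \<Xi> x * F x)"
      using GF by (intro Bochner_Integration.integral_cong) (auto simp: indicator_def)
    thus ?thesis using \<open>0 < p\<close> by (simp add: m_def)
  qed
  have exp\<Xi>: "expectation (indicator \<Xi>) = p" by (simp add: p_def)
  have p1: "p \<le> 1" by (simp add: p_def)
  \<comment> \<open>The conditional mean \<open>m\<close> and the values of \<open>G\<close> off
    \<open>\<Xi>\<close> lie in the same interval of length \<open>c * N\<close>; only the mass
    \<open>1 - p\<close> off \<open>\<Xi>\<close> contributes to \<open>\<delta>\<close>.\<close>
  have crude: "\<bar>\<delta>\<bar> \<le> (1 - p) * real (card I) * c"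
  proof -
    define r where "r = expectation (\<lambda>x. (1 - indicator \<Xi> x) * G x)"
    have intc: "integrable P (\<lambda>x. (1 - indicator \<Xi> x) * G x)"
      using intG int\<Xi>G by (simp add: left_diff_distrib)
    have EG: "expectation G = p * m + r"
    proof -
      have "expectation G = expectation (\<lambda>x. indicator \<Xi> x * G x + (1 - indicator \<Xi> x) * G x)"
        by (intro Bochner_Integration.integral_cong) (auto simp: algebra_simps)
      also have "\<dots> = p * m + r"
        unfolding r_def m[symmetric] by (rule Bochner_Integration.integral_add[OF int\<Xi>G intc])
      finally show ?thesis .
    qed
    have c1: "expectation (\<lambda>x. (1 - indicator \<Xi> x) * a) = (1 - p) * a" for a :: real
      using exp\<Xi> int\<Xi> by (simp add: prob_space)
    have c2: "expectation (\<lambda>x. indicator \<Xi> x * a) = p * a" for a :: real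
      using exp\<Xi> int\<Xi> by simp
    have "expectation (\<lambda>x. (1 - indicator \<Xi> x) * lo) \<le> r" "r \<le> expectation (\<lambda>x. (1 - indicator \<Xi> x) * (lo + c * N))"
      unfolding r_def using int\<Xi> G_lo G_hi
      by (intro integral_mono intc mult_left_mono Bochner_Integration.integrable_mult_left
          Bochner_Integration.integrable_diff integrable_const; force simp: indicator_def)+
    moreover have "expectation (\<lambda>x. indicator \<Xi> x * lo) \<le> p * m" "p * m \<le> expectation (\<lambda>x. indicator \<Xi> x * (lo + c * N))"
      unfolding m[symmetric] using int\<Xi> G_lo G_hi
      by (intro integral_mono int\<Xi>G mult_left_mono Bochner_Integration.integrable_mult_left; force)+
    ultimately have r: "(1 - p) * lo \<le> r" "r \<le> (1 - p) * (lo + c * N)"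
      and "lo \<le> m" "m \<le> lo + c * N"
      using \<open>0 < p\<close> unfolding c1 c2 by auto
    hence "(1 - p) * lo \<le> (1 - p) * m" "(1 - p) * m \<le> (1 - p) * (lo + c * N)"
      using p1 by (auto intro!: mult_left_mono)
    with r have "\<bar>(1 - p) * m - r\<bar> \<le> (1 - p) * (c * N)"
      by (simp add: abs_le_iff algebra_simps)
    thus ?thesis by (simp add: \<delta>_def EG N_def algebra_simps)
  qed
  \<comment> \<open>On \<open>\<Xi>\<close> the exponential is bounded below by its tangent,
    elsewhere by 0. The linear term integrates to 0 because \<open>m\<close> is the mean of
    \<open>G\<close> on \<open>\<Xi>\<close>.\<close>
  have jensen: "p * exp (l * \<delta>) \<le> exp (l\<^sup>2 * K / 8)" for l
  proof -
    have "p = expectation (\<lambda>x. indicator \<Xi> x + l * (indicator \<Xi> x * G x) - l * m * indicator \<Xi> x)"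
      using int\<Xi> int\<Xi>G m exp\<Xi> by simp
    also have "\<dots> \<le> expectation (\<lambda>x. exp (l * (G x - m)))"
    proof (rule integral_mono)
      fix x assume "x \<in> space P"
      have "1 + l * (G x - m) \<le> exp (l * (G x - m))" by (rule exp_ge_add_one_self)
      thus "indicator \<Xi> x + l * (indicator \<Xi> x * G x) - l * m * indicator \<Xi> x \<le> exp (l * (G x - m))"
        by (auto simp: indicator_def algebra_simps)
    qed (use int\<Xi> int\<Xi>G intexp in auto)
    finally have "p * exp (l * \<delta>) \<le> expectation (\<lambda>x. exp (l * (G x - m))) * exp (l * \<delta>)"
      by (intro mult_right_mono) auto
    also have "\<dots> = expectation (\<lambda>x. exp (l * (G x - m)) * exp (l * \<delta>))" by simp
    also have "\<dots> = expectation (\<lambda>x. exp (l * (G x - expectation G)))"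
      by (intro Bochner_Integration.integral_cong) (auto simp: \<delta>_def algebra_simps simp flip: exp_add)
    also have "\<dots> \<le> exp (l\<^sup>2 * K / 8)" by (rule mgf)
    finally show ?thesis .
  qed
  have "p \<le> exp (- (2 * \<delta>\<^sup>2 / K))"
  proof -
    \<comment> \<open>\<open>l = 4 * \<delta> / K\<close> minimizes
      \<open>l\<^sup>2 * K / 8 - l * \<delta>\<close>.\<close>
    have "p = p * exp (4 * \<delta> / K * \<delta>) * exp (- (4 * \<delta> / K * \<delta>))"
      by (simp add: mult.assoc flip: exp_add)
    also have "\<dots> \<le> exp ((4 * \<delta> / K)\<^sup>2 * K / 8) * exp (- (4 * \<delta> / K * \<delta>))"
      by (intro mult_right_mono jensen) auto
    also have "\<dots> = exp (- (2 * \<delta>\<^sup>2 / K))"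
      using K by (simp add: power2_eq_square field_simps flip: exp_add)
    finally show ?thesis .
  qed
  \<comment> \<open>Chernoff's bound for both tails at once: the sign of \<open>s\<close> selects
    the direction, and \<open>l = 4 * s / K\<close> is again the optimal parameter.\<close>
  have tail: "prob A \<le> exp (- (2 * s\<^sup>2 / K))"
    if A[measurable]: "A \<in> events" and "\<And>x. x \<in> A \<Longrightarrow> s\<^sup>2 \<le> s * (G x - expectation G)" for A s
  proof -
    define l where "l = 4 * s / K"
    have "expectation (\<lambda>x. exp (l * s) * indicator A x) \<le> expectation (\<lambda>x. exp (l * (G x - expectation G)))"
    proof (rule integral_mono)
      fix x assume "x \<in> space P"
      show "exp (l * s) * indicator A x \<le> exp (l * (G x - expectation G))"
      proof (cases "x \<in> A")
        case True
        have "4 / K * s\<^sup>2 \<le> 4 / K * (s * (G x - expectation G))"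
          using K that(2)[OF True] by (intro mult_left_mono) auto
        thus ?thesis using True by (simp add: l_def power2_eq_square)
      qed auto
    qed (use intexp in \<open>auto simp: emeasure_eq_measure\<close>)
    also have "\<dots> \<le> exp (l\<^sup>2 * K / 8)" by (rule mgf)
    finally have "exp (l * s) * prob A \<le> exp (l\<^sup>2 * K / 8)" by simp
    hence "exp (- (l * s)) * (exp (l * s) * prob A) \<le> exp (- (l * s)) * exp (l\<^sup>2 * K / 8)"
      by (intro mult_left_mono) auto
    also have "\<dots> = exp (- (2 * s\<^sup>2 / K))"
      using K by (simp add: l_def power2_eq_square field_simps flip: exp_add)
    finally show ?thesis by (simp add: mult.assoc[symmetric] flip: exp_add)
  qed
  show ?thesis
  proof (rule that[OF crude \<open>p \<le> exp (- (2 * \<delta>\<^sup>2 / K))\<close>])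
    fix t assume t: "0 \<le> t + \<delta>"
    show "prob {z \<in> \<Xi>. m + t < F z} \<le> exp (- (2 * (t + \<delta>)\<^sup>2 / K))"
    proof (rule tail)
      fix x assume "x \<in> {z \<in> \<Xi>. m + t < F z}"
      hence "t + \<delta> \<le> G x - expectation G" by (simp add: GF \<delta>_def)
      with t show "(t + \<delta>)\<^sup>2 \<le> (t + \<delta>) * (G x - expectation G)"
        by (simp add: power2_eq_square mult_left_mono)
    qed measurable
  next
    fix t assume t: "0 \<le> t - \<delta>"
    have "prob {z \<in> \<Xi>. F z < m - t} \<le> exp (- (2 * (\<delta> - t)\<^sup>2 / K))"
    proof (rule tail)
      fix x assume "x \<in> {z \<in> \<Xi>. F z < m - t}"
      hence "G x - expectation G \<le> \<delta> - t" by (simp add: GF \<delta>_def)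
      with t show "(\<delta> - t)\<^sup>2 \<le> (\<delta> - t) * (G x - expectation G)"
        by (simp add: power2_eq_square mult_left_mono_neg)
    qed measurable
    thus "prob {z \<in> \<Xi>. F z < m - t} \<le> exp (- (2 * (t - \<delta>)\<^sup>2 / K))"
      by (simp add: power2_commute)
  qed
qed

section \<open>Risk of the leave-one-out reconstructions\<close>

text \<open>The first bound takes the worst \<open>\<delta>\<close> for each tail separately. The
  second keeps \<open>\<delta>\<close> and lowers \<open>\<epsilon>\<close> to
  \<open>\<gamma> * n * c\<close>, which increases both terms and leaves a second difference of the
  Gaussian.\<close>

lemma two_sided_tail_bounds:
  fixes n c \<epsilon> \<delta> \<gamma> :: real
  defines "K \<equiv> c\<^sup>2 * n"
  defines "S \<equiv> exp (- (2 * (\<epsilon> + \<delta>)\<^sup>2 / K)) + exp (- (2 * (\<epsilon> - \<delta>)\<^sup>2 / K))"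
  assumes "0 < n" and "0 < c" and "0 \<le> \<gamma>" and \<delta>: "\<bar>\<delta>\<bar> \<le> \<gamma> * n * c" and \<epsilon>: "\<gamma> * n * c < \<epsilon>"
    and \<gamma>: "1 - \<gamma> \<le> exp (- (2 * \<delta>\<^sup>2 / K))"
  shows "S \<le> 2 * exp (- (2 * (\<epsilon> - \<gamma> * n * c)\<^sup>2 / K))"
    and "\<gamma> \<le> 1 / 2 \<Longrightarrow> S \<le> \<gamma> + 2 * exp (- (2 * n * \<gamma>\<^sup>2))"
proof -
  have K: "0 < K" using assms by (simp add: K_def)
  have mono: "exp (- (2 * t\<^sup>2 / K)) \<le> exp (- (2 * s\<^sup>2 / K))" if "0 \<le> s" "s \<le> t" for s t
    using that K by (simp add: divide_right_mono power_mono)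
  have "exp (- (2 * (\<epsilon> + \<delta>)\<^sup>2 / K)) \<le> exp (- (2 * (\<epsilon> - \<gamma> * n * c)\<^sup>2 / K))"
    "exp (- (2 * (\<epsilon> - \<delta>)\<^sup>2 / K)) \<le> exp (- (2 * (\<epsilon> - \<gamma> * n * c)\<^sup>2 / K))"
    by (rule mono; use \<delta> \<epsilon> in linarith)+
  thus "S \<le> 2 * exp (- (2 * (\<epsilon> - \<gamma> * n * c)\<^sup>2 / K))"
    unfolding S_def by linarith
  assume half: "\<gamma> \<le> 1 / 2"
  \<comment> \<open>Rescaling by \<open>k\<close> makes the exponents plain squares, with
    \<open>x\<^sup>2 = 2 * n * \<gamma>\<^sup>2\<close>. The condition on \<open>y\<close> holds
    since \<open>1 / 2 \<le> 1 - \<gamma> \<le> exp (- (y\<^sup>2))\<close>.\<close>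
  define k where "k = sqrt (2 / K)"
  define y where "y = k * \<bar>\<delta>\<bar>"
  define x where "x = k * (\<gamma> * n * c)"
  have k: "0 \<le> k" "k\<^sup>2 = 2 / K" using K by (auto simp: k_def)
  have nonneg: "0 \<le> \<gamma> * n * c" using assms by simp
  have y2: "y\<^sup>2 = 2 * \<delta>\<^sup>2 / K" by (simp add: y_def power_mult_distrib k)
  have x2: "x\<^sup>2 = 2 * n * \<gamma>\<^sup>2"
  proof -
    have "x\<^sup>2 = 2 / K * (\<gamma> * n * c)\<^sup>2" unfolding x_def power_mult_distrib[of k] k ..
    thus ?thesis using \<open>0 < n\<close> \<open>0 < c\<close> by (simp add: K_def power2_eq_square field_simps)
  qed
  have "S = exp (- (2 * (\<epsilon> + \<bar>\<delta>\<bar>)\<^sup>2 / K)) + exp (- (2 * (\<epsilon> - \<bar>\<delta>\<bar>)\<^sup>2 / K))"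
    unfolding S_def by (cases "\<delta> \<ge> 0") auto
  also have "\<dots> \<le> exp (- (2 * (\<gamma> * n * c + \<bar>\<delta>\<bar>)\<^sup>2 / K)) + exp (- (2 * (\<gamma> * n * c - \<bar>\<delta>\<bar>)\<^sup>2 / K))"
    using \<delta> \<epsilon> nonneg by (intro add_mono mono) auto
  also have "\<dots> = exp (- ((x + y)\<^sup>2)) + exp (- ((x - y)\<^sup>2))"
  proof -
    have "x + y = k * (\<gamma> * n * c + \<bar>\<delta>\<bar>)" "x - y = k * (\<gamma> * n * c - \<bar>\<delta>\<bar>)"
      by (auto simp: x_def y_def distrib_left right_diff_distrib)
    thus ?thesis by (simp only: power_mult_distrib k times_divide_eq_left)
  qed
  also have "\<dots> \<le> 1 - exp (- (y\<^sup>2)) + 2 * exp (- (x\<^sup>2))"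
    using gaussian_second_difference_le[of x y] k nonneg \<gamma> half by (simp add: x_def y_def[symmetric] y2) (simp add: y_def)
  also have "\<dots> \<le> \<gamma> + 2 * exp (- (2 * n * \<gamma>\<^sup>2))"
    using \<gamma> by (simp add: y2 x2)
  finally show "S \<le> \<gamma> + 2 * exp (- (2 * n * \<gamma>\<^sup>2))" .
qed

text \<open>Measurability of \<open>R\<close> is given for lists indexed by \<open>{1..<n}\<close>;
  the reindexing jumps over \<open>i\<close>.\<close>

lemma leave_out_eq_map:
  assumes "i \<in> {1..n}"
  shows "leave_out n z i = map (\<lambda>j. z (if j < i then j else Suc j)) [1..<n]"
proof -
  have "[1..<Suc n] = [1..<i] @ [i..<Suc n]"
    using assms upt_add_eq_append[of 1 i "Suc n - i"] by simp
  also have "[i..<Suc n] = i # [Suc i..<Suc n]"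
    using assms by (intro upt_conv_Cons) auto
  finally have "[1..<Suc n] = [1..<i] @ i # [Suc i..<Suc n]" .
  hence "filter (\<lambda>j. j \<noteq> i) [1..<Suc n] = [1..<i] @ [Suc i..<Suc n]"
    by (auto simp: filter_id_conv)
  moreover have "[1..<n] = [1..<i] @ [i..<n]"
    using assms upt_add_eq_append[of 1 i "n - i"] by simp
  moreover have "map z [Suc i..<Suc n] = map (\<lambda>j. z (Suc j)) [i..<n]"
    by (simp only: map_Suc_upt[symmetric] map_map comp_def)
  ultimately show ?thesis by (auto simp: leave_out_def)
qed

section \<open>Size, Lipschitz continuity and measurability of the risk\<close>

lemma sup_norm_less_imp_le:
  assumes "sup_norm \<Omega> g < ennreal C" and "x \<in> \<Omega>"
  shows "cmod (g x) \<le> C"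
proof -
  have "ennreal (cmod (g x)) \<le> sup_norm \<Omega> g" unfolding sup_norm_def using assms(2) by (rule SUP_upper)
  also have "\<dots> < ennreal C" by fact
  finally show ?thesis by (simp add: ennreal_less_iff)
qed

lemma (in prob_space) risk_le:
  assumes "sup_norm (space M) (\<lambda>x. g x - f x) < ennreal C"
  shows "risk M f g \<le> ennreal (C\<^sup>2)"
proof -
  have "risk M f g \<le> (\<integral>\<^sup>+x. ennreal (C\<^sup>2) \<partial>M)"
    unfolding risk_def using sup_norm_less_imp_le[OF assms]
    by (intro nn_integral_mono ennreal_leI power_mono) auto
  thus ?thesis by (simp add: emeasure_space_1)
qed

text \<open>Pointwise, \<open>u\<^sup>2 - v\<^sup>2 = (u - v) * (u + v)\<close>, where the first
  factor is at most \<open>D\<close> and the second at most \<open>2 * C\<close>.\<close>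

lemma (in prob_space) risk_diff_le:
  assumes [measurable]: "f \<in> borel_measurable M" "g \<in> borel_measurable M" "h \<in> borel_measurable M"
    and g: "sup_norm (space M) (\<lambda>x. g x - f x) < ennreal C"
    and h: "sup_norm (space M) (\<lambda>x. h x - f x) < ennreal C"
    and D: "\<And>x. x \<in> space M \<Longrightarrow> cmod (g x - h x) \<le> D" and "0 \<le> C" "0 \<le> D"
  shows "enn2real (risk M f g) - enn2real (risk M f h) \<le> 2 * C * D"
proof -
  have "risk M f g \<le> (\<integral>\<^sup>+x. ennreal ((cmod (h x - f x))\<^sup>2) + ennreal (2 * C * D) \<partial>M)"
    unfolding risk_def
  proof (rule nn_integral_mono)
    fix x assume x: "x \<in> space M"
    define u v where "u = cmod (g x - f x)" and "v = cmod (h x - f x)"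
    have "u \<le> C" "v \<le> C" using sup_norm_less_imp_le[OF g x] sup_norm_less_imp_le[OF h x] by (auto simp: u_def v_def)
    moreover have "u - v \<le> D"
      using norm_triangle_ineq2[of "g x - f x" "h x - f x"] D[OF x] by (simp add: u_def v_def)
    moreover have "0 \<le> u" "0 \<le> v" by (auto simp: u_def v_def)
    ultimately have "(u - v) * (u + v) \<le> D * (2 * C)"
      using \<open>0 \<le> D\<close> by (intro mult_mono) auto
    hence "u\<^sup>2 \<le> v\<^sup>2 + 2 * C * D" by (simp add: power2_eq_square algebra_simps)
    thus "ennreal ((cmod (g x - f x))\<^sup>2) \<le> ennreal ((cmod (h x - f x))\<^sup>2) + ennreal (2 * C * D)"
      using \<open>0 \<le> C\<close> \<open>0 \<le> D\<close> by (simp add: u_def v_def ennreal_leI flip: ennreal_plus)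
  qed
  also have "\<dots> = risk M f h + ennreal (2 * C * D)"
    unfolding risk_def by (subst nn_integral_add) (auto simp: emeasure_space_1)
  finally have le: "risk M f g \<le> risk M f h + ennreal (2 * C * D)" .
  have "risk M f h < top" using risk_le[OF h] by (rule le_less_trans) simp
  hence "enn2real (risk M f g) \<le> enn2real (risk M f h + ennreal (2 * C * D))"
    using le by (intro enn2real_mono) (auto simp: less_top)
  also have "\<dots> = enn2real (risk M f h) + 2 * C * D"
    using \<open>risk M f h < top\<close> \<open>0 \<le> C\<close> \<open>0 \<le> D\<close> by (subst enn2real_plus) auto
  finally show ?thesis by simp
qed

text \<open>The left-out sample depends on the inputs through the measurable map
  \<open>\<psi>\<close>. Joint measurability in inputs and evaluation point then passes to the risk
  by Tonelli.\<close>

lemma borel_measurable_risk_leave_out: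
  fixes \<rho> :: "'a measure" and f :: "'a \<Rightarrow> complex"
  assumes "prob_space \<rho>" and f: "f \<in> borel_measurable \<rho>" "f \<in> space \<rho> \<rightarrow> Y"
    and R: "(\<lambda>(z, x). R (map z [1..<n]) x) \<in> borel_measurable
           (Pi\<^sub>M {1..<n} (\<lambda>_. \<rho> \<Otimes>\<^sub>M restrict_space borel Y) \<Otimes>\<^sub>M \<rho>)"
    and i: "i \<in> {1..n}"
  defines "\<phi> \<equiv> \<lambda>x. \<lambda>j\<in>{1..n}. (x j, f (x j))"
  shows "\<phi> \<in> measurable (Pi\<^sub>M {1..n} (\<lambda>_. \<rho>)) (Pi\<^sub>M {1..n} (\<lambda>_. \<rho> \<Otimes>\<^sub>M restrict_space borel Y))"
    and "x \<in> space (Pi\<^sub>M {1..n} (\<lambda>_. \<rho>)) \<Longrightarrow> R (leave_out n (\<phi> x) i) \<in> borel_measurable \<rho>"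
    and "(\<lambda>x. risk \<rho> f (R (leave_out n (\<phi> x) i))) \<in> borel_measurable (Pi\<^sub>M {1..n} (\<lambda>_. \<rho>))"
proof -
  interpret prob_space \<rho> by fact
  let ?Q = "Pi\<^sub>M {1..n} (\<lambda>_. \<rho>)" and ?\<nu> = "\<rho> \<Otimes>\<^sub>M restrict_space borel Y"
  have [measurable]: "f \<in> measurable \<rho> (restrict_space borel Y)"
    using f by (rule measurable_restrict_space2[rotated])
  have graph: "(\<lambda>x. (x, f x)) \<in> measurable \<rho> ?\<nu>" by measurable
  have coord: "(\<lambda>x. (x j, f (x j))) \<in> measurable ?Q ?\<nu>" if "j \<in> {1..n}" for j
    by (rule measurable_compose[OF measurable_component_singleton[OF that] graph])
  show "\<phi> \<in> measurable ?Q (Pi\<^sub>M {1..n} (\<lambda>_. ?\<nu>))"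
    unfolding \<phi>_def by (rule measurable_restrict[OF coord])
  define \<sigma> where "\<sigma> j = (if j < i then j else Suc j)" for j
  have \<sigma>: "\<sigma> j \<in> {1..n}" if "j \<in> {1..<n}" for j
    using that i by (auto simp: \<sigma>_def)
  define \<psi> where "\<psi> x = (\<lambda>j\<in>{1..<n}. (x (\<sigma> j), f (x (\<sigma> j))))" for x :: "nat \<Rightarrow> 'a"
  have \<psi>[measurable]: "\<psi> \<in> measurable ?Q (Pi\<^sub>M {1..<n} (\<lambda>_. ?\<nu>))"
    unfolding \<psi>_def by (intro measurable_restrict coord \<sigma>)
  have eq: "leave_out n (\<phi> x) i = map (\<psi> x) [1..<n]" for x
    unfolding leave_out_eq_map[OF i]
    using \<sigma> by (intro map_cong) (auto simp: \<phi>_def \<psi>_def \<sigma>_def)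
  have "(\<lambda>(x, t). (\<psi> x, t)) \<in> measurable (?Q \<Otimes>\<^sub>M \<rho>) (Pi\<^sub>M {1..<n} (\<lambda>_. ?\<nu>) \<Otimes>\<^sub>M \<rho>)"
    by measurable
  from measurable_compose[OF this R]
  have joint[measurable]: "(\<lambda>(x, t). R (leave_out n (\<phi> x) i) t) \<in> borel_measurable (?Q \<Otimes>\<^sub>M \<rho>)"
    by (simp add: eq case_prod_beta')
  show "R (leave_out n (\<phi> x) i) \<in> borel_measurable \<rho>" if "x \<in> space ?Q"
    using measurable_compose[OF measurable_Pair1'[OF that] joint] by simp
  have "(\<lambda>(x, t). ennreal ((cmod (R (leave_out n (\<phi> x) i) t - f t))\<^sup>2)) \<in> borel_measurable (?Q \<Otimes>\<^sub>M \<rho>)"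
    using f(1) joint by (simp add: case_prod_beta')
  thus "(\<lambda>x. risk \<rho> f (R (leave_out n (\<phi> x) i))) \<in> borel_measurable ?Q"
    unfolding risk_def by (rule borel_measurable_nn_integral)
qed

theorem theorem3p4:
  fixes \<rho> :: "'a measure" and P :: "'w measure" and Y :: "complex set"
    and f :: "'a \<Rightarrow> complex" and R :: "('a \<times> complex) list \<Rightarrow> 'a \<Rightarrow> complex"
    and X :: "nat \<Rightarrow> 'w \<Rightarrow> 'a" and Z :: "'w \<Rightarrow> nat \<Rightarrow> 'a \<times> complex"
    and \<Xi> :: "(nat \<Rightarrow> 'a \<times> complex) set"
    and n i :: nat and C1 C2 \<gamma> \<epsilon> :: real and m :: ennreal
  assumes "prob_space \<rho>" and "prob_space P"
    and f_meas: "f \<in> borel_measurable \<rho>" and f_val: "f \<in> space \<rho> \<rightarrow> Y"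
    and R_val: "\<And>zs. length zs = n - 1 \<Longrightarrow> set zs \<subseteq> space \<rho> \<times> Y \<Longrightarrow> R zs \<in> space \<rho> \<rightarrow> Y"
    and R_meas: "(\<lambda>(z, x). R (map z [1..<n]) x) \<in> borel_measurable
           (PiM {1..<n} (\<lambda>_. \<rho> \<Otimes>\<^sub>M restrict_space borel Y) \<Otimes>\<^sub>M \<rho>)"
    and X_indep: "prob_space.indep_vars P (\<lambda>_. \<rho>) X {1..n}"
    and X_distr: "\<And>j. j \<in> {1..n} \<Longrightarrow> distr P \<rho> (X j) = \<rho>"
    and Z_eq: "Z = (\<lambda>\<omega>. \<lambda>j\<in>{1..n}. (X j \<omega>, f (X j \<omega>)))"
    and "C1 > 0" and "C2 > 0" and "C2 \<le> 2 * C1"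
    and \<Xi>_adm: "admissible_samples (space \<rho>) Y f R n C1 C2 \<Xi>"
    and \<Xi>_meas: "\<Xi> \<in> sets (PiM {1..n} (\<lambda>_. \<rho> \<Otimes>\<^sub>M restrict_space borel Y))"
    and \<Xi>_pos: "measure P {\<omega> \<in> space P. Z \<omega> \<in> \<Xi>} > 0"
    and \<gamma>_eq: "\<gamma> = 1 - measure P {\<omega> \<in> space P. Z \<omega> \<in> \<Xi>}"
    and i: "i \<in> {1..n}"
    and m_eq: "m = expectation_given P (\<lambda>\<omega>. risk \<rho> f (R (leave_out n (Z \<omega>) i)))
                     {\<omega> \<in> space P. Z \<omega> \<in> \<Xi>}"
    and \<epsilon>: "\<epsilon> > 2 * \<gamma> * real n * C1 * C2"
  shows "let p = measure P {\<omega> \<in> space P.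
               \<bar>enn2ereal (risk \<rho> f (R (leave_out n (Z \<omega>) i))) - enn2ereal m\<bar> > ereal \<epsilon>};
             a = \<epsilon> / (sqrt (2 * real n) * C1 * C2) - sqrt (2 * real n) * \<gamma>;
             b = \<epsilon> / (sqrt (8 * real n) * C1\<^sup>2) - sqrt (2 * real n) * \<gamma>
         in p \<le> 2 * \<gamma> + 2 * exp (- (a\<^sup>2)) \<and>
            p \<le> 2 * \<gamma> + 2 * exp (- (b\<^sup>2)) \<and>
            (0 \<le> a + b \<longrightarrow> 2 * \<gamma> + 2 * exp (- (a\<^sup>2)) \<le> 2 * \<gamma> + 2 * exp (- (b\<^sup>2)))"
proof -
  interpret \<rho>: prob_space \<rho> by fact
  interpret prob_space P by fact
  \<comment> \<open>All randomness sits in the inputs: \<open>Z\<close> is \<open>\<phi>\<close>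
    after \<open>T\<close>, and \<open>T\<close> maps \<open>P\<close> to the product measure
    \<open>Q\<close>. The concentration lemma is applied on \<open>Q\<close>, with
    \<open>\<Theta>\<close> the pullback of \<open>\<Xi>\<close>.\<close>
  define Q where "Q = Pi\<^sub>M {1..n} (\<lambda>_. \<rho>)"
  define \<phi> where "\<phi> x = (\<lambda>j\<in>{1..n}. (x j, f (x j)))" for x :: "nat \<Rightarrow> 'a"
  define T where "T \<omega> = (\<lambda>j\<in>{1..n}. X j \<omega>)" for \<omega>
  define rk where "rk x = risk \<rho> f (R (leave_out n (\<phi> x) i))" for x
  define \<Theta> where "\<Theta> = \<phi> -` \<Xi> \<inter> space Q"
  \<comment> \<open>An infinite risk becomes 0 here; this is harmless because \<open>F\<close> is
    evaluated only on \<open>\<Theta>\<close>, where the risk is at most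
    \<open>C1\<^sup>2\<close>.\<close>
  define F where "F x = enn2real (rk x)" for x
  define c where "c = 2 * C1 * C2"
  have c: "0 < c" using \<open>C1 > 0\<close> \<open>C2 > 0\<close> by (simp add: c_def)
  have n: "1 \<le> n" using i by auto
  interpret Q: prob_space Q unfolding Q_def by (intro prob_space_PiM assms)
  have rv: "X j \<in> measurable P \<rho>" if "j \<in> {1..n}" for j
    using X_indep that by (auto simp: indep_vars_def)
  have T[measurable]: "T \<in> measurable P Q"
    unfolding T_def Q_def by (rule measurable_restrict[OF rv])
  have distr: "distr P Q T = Q"
  proof -
    have "distr P Q T = Pi\<^sub>M {1..n} (\<lambda>j. distr P \<rho> (X j))"
      using X_indep n by (subst (asm) indep_vars_iff_distr_eq_PiM') (auto simp: rv Q_def T_def[abs_def])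
    also have "\<dots> = Q" unfolding Q_def by (rule PiM_cong) (auto simp: X_distr)
    finally show ?thesis .
  qed
  have ZT: "Z \<omega> = \<phi> (T \<omega>)" for \<omega>
    by (auto simp: Z_eq \<phi>_def T_def)
  note risk_meas = borel_measurable_risk_leave_out[OF \<open>prob_space \<rho>\<close> f_meas f_val R_meas i,
      folded Q_def \<phi>_def]
  have \<phi>[measurable]: "\<phi> \<in> measurable Q (Pi\<^sub>M {1..n} (\<lambda>_. \<rho> \<Otimes>\<^sub>M restrict_space borel Y))"
    using risk_meas(1) by (simp add: \<phi>_def[abs_def])
  have R_fun: "R (leave_out n (\<phi> x) i) \<in> borel_measurable \<rho>" if "x \<in> \<Theta>" for x
    using risk_meas(2)[of x] that by (simp add: \<Theta>_def \<phi>_def[abs_def])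
  have rk[measurable]: "rk \<in> borel_measurable Q"
    using risk_meas(3) by (simp add: rk_def[abs_def] \<phi>_def[abs_def])
  have \<Theta>[measurable]: "\<Theta> \<in> sets Q" unfolding \<Theta>_def using \<phi> \<Xi>_meas by (rule measurable_sets)
  have [measurable]: "F \<in> borel_measurable Q" unfolding F_def by measurable
  have T_\<Theta>: "T \<omega> \<in> \<Theta> \<longleftrightarrow> Z \<omega> \<in> \<Xi>" if "\<omega> \<in> space P" for \<omega>
    using measurable_space[OF T that] by (simp add: \<Theta>_def ZT)
  have pull: "prob {\<omega> \<in> space P. T \<omega> \<in> A} = measure Q A" if "A \<in> sets Q" for A
    using measure_distr[OF T that] by (simp add: distr vimage_def Int_def conj_commute)
  have adm: "sup_norm (space \<rho>) (\<lambda>t. R (leave_out n (\<phi> x) i) t - f t) < ennreal C1" if "x \<in> \<Theta>" for x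
    using \<Xi>_adm that i by (auto simp: admissible_samples_def \<Theta>_def)
  have rk_le: "rk x \<le> ennreal (C1\<^sup>2)" if "x \<in> \<Theta>" for x
    unfolding rk_def by (rule \<rho>.risk_le[OF adm[OF that]])
  have rk_F: "rk x = ennreal (F x)" if "x \<in> \<Theta>" for x
    unfolding F_def using le_less_trans[OF rk_le[OF that] ennreal_less_top]
    by (intro ennreal_enn2real[symmetric]) simp
  have F_nonneg: "0 \<le> F x" for x by (simp add: F_def)
  \<comment> \<open>Samples can differ only where the inputs do, and counting coordinate
    \<open>i\<close> as well only enlarges the bound.\<close>
  have lip: "F x - F y \<le> c * real (card {j \<in> {1..n}. x j \<noteq> y j})" if "x \<in> \<Theta>" "y \<in> \<Theta>" for x y
  proof -
    have "F x - F y \<le> 2 * C1 * (C2 * real (card {j \<in> {1..n}. x j \<noteq> y j}))"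
      unfolding F_def rk_def
    proof (rule \<rho>.risk_diff_le[OF f_meas R_fun[OF that(1)] R_fun[OF that(2)] adm[OF that(1)] adm[OF that(2)]])
      fix t assume "t \<in> space \<rho>"
      hence "cmod (R (leave_out n (\<phi> x) i) t - R (leave_out n (\<phi> y) i) t)
          \<le> C2 * real (card {j \<in> {1..n} - {i}. \<phi> x j \<noteq> \<phi> y j})"
        using \<Xi>_adm that i by (auto simp: admissible_samples_def \<Theta>_def)
      also have "\<dots> \<le> C2 * real (card {j \<in> {1..n}. x j \<noteq> y j})"
        using \<open>C2 > 0\<close> by (intro mult_left_mono of_nat_mono card_mono) (auto simp: \<phi>_def)
      finally show "cmod (R (leave_out n (\<phi> x) i) t - R (leave_out n (\<phi> y) i) t)
          \<le> C2 * real (card {j \<in> {1..n}. x j \<noteq> y j})" .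
    qed (use \<open>C1 > 0\<close> \<open>C2 > 0\<close> in auto)
    thus ?thesis by (simp add: c_def mult.assoc)
  qed
  define p where "p = measure Q \<Theta>"
  have p_eq: "p = prob {\<omega> \<in> space P. Z \<omega> \<in> \<Xi>}"
  proof -
    have "{\<omega> \<in> space P. Z \<omega> \<in> \<Xi>} = {\<omega> \<in> space P. T \<omega> \<in> \<Theta>}" using T_\<Theta> by auto
    thus ?thesis using pull[OF \<Theta>] by (simp add: p_def)
  qed
  have p: "0 < p" "p = 1 - \<gamma>" "p \<le> 1"
    using \<Xi>_pos \<gamma>_eq p_eq by (auto simp: p_def)
  define mr where "mr = (\<integral>x. indicator \<Theta> x * F x \<partial>Q) / p"
  have m: "m = ennreal mr"
  proof -
    have int: "integrable Q (\<lambda>x. indicator \<Theta> x * F x)"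
    proof (rule Q.integrable_const_bound[where B = "C1\<^sup>2"])
      show "AE x in Q. norm (indicator \<Theta> x * F x) \<le> C1\<^sup>2"
        using rk_le rk_F F_nonneg by (intro AE_I2) (auto simp: indicator_def)
    qed measurable
    have "(\<integral>\<^sup>+\<omega>. indicator {\<omega> \<in> space P. Z \<omega> \<in> \<Xi>} \<omega> * risk \<rho> f (R (leave_out n (Z \<omega>) i)) \<partial>P)
        = (\<integral>\<^sup>+\<omega>. indicator \<Theta> (T \<omega>) * rk (T \<omega>) \<partial>P)"
      using T_\<Theta> by (intro nn_integral_cong) (auto simp: rk_def ZT indicator_def)
    also have "\<dots> = (\<integral>\<^sup>+x. indicator \<Theta> x * rk x \<partial>distr P Q T)"
      by (subst nn_integral_distr) auto
    also have "\<dots> = (\<integral>\<^sup>+x. ennreal (indicator \<Theta> x * F x) \<partial>Q)"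
      unfolding distr using rk_F by (intro nn_integral_cong) (auto simp: indicator_def)
    also have "\<dots> = ennreal (\<integral>x. indicator \<Theta> x * F x \<partial>Q)"
      using int F_nonneg by (intro nn_integral_eq_integral) auto
    finally show ?thesis
      unfolding m_eq expectation_given_def emeasure_eq_measure mr_def p_eq[symmetric]
      using p F_nonneg by (simp add: divide_ennreal)
  qed
  have mr_nonneg: "0 \<le> mr" using p F_nonneg by (simp add: mr_def)
  have card: "real (card {1..n}) = real n" by simp
  obtain \<delta> where \<delta>: "\<bar>\<delta>\<bar> \<le> (1 - p) * real n * c" "p \<le> exp (- (2 * \<delta>\<^sup>2 / (c\<^sup>2 * real n)))"
    and up: "\<And>t. 0 \<le> t + \<delta> \<Longrightarrow> measure Q {x \<in> \<Theta>. mr + t < F x} \<le> exp (- (2 * (t + \<delta>)\<^sup>2 / (c\<^sup>2 * real n)))"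
    and down: "\<And>t. 0 \<le> t - \<delta> \<Longrightarrow> measure Q {x \<in> \<Theta>. F x < mr - t} \<le> exp (- (2 * (t - \<delta>)\<^sup>2 / (c\<^sup>2 * real n)))"
  proof (rule concentration_on_subset[of \<rho> "{1..n}" c F \<Theta>, folded Q_def, folded p_def, folded mr_def, unfolded card], goal_cases)
    case (9 \<delta>)
    show ?case by (rule that[of \<delta>]) (fact 9)+
  qed (use \<open>prob_space \<rho>\<close> n c p(1) lip in auto)
  define S where "S = exp (- (2 * (\<epsilon> + \<delta>)\<^sup>2 / (c\<^sup>2 * real n))) + exp (- (2 * (\<epsilon> - \<delta>)\<^sup>2 / (c\<^sup>2 * real n)))"
  define q where "q = prob {\<omega> \<in> space P.
      \<bar>enn2ereal (risk \<rho> f (R (leave_out n (Z \<omega>) i))) - enn2ereal m\<bar> > ereal \<epsilon>}"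
  have \<gamma>: "0 \<le> \<gamma>" using p by simp
  have \<epsilon>': "\<gamma> * real n * c < \<epsilon>" using \<epsilon> by (simp add: c_def mult_ac)
  have \<delta>': "\<bar>\<delta>\<bar> \<le> \<gamma> * real n * c" "1 - \<gamma> \<le> exp (- (2 * \<delta>\<^sup>2 / (c\<^sup>2 * real n)))"
    using \<delta> p by auto
  \<comment> \<open>The complement of \<open>\<Theta>\<close> costs \<open>\<gamma>\<close>; on
    \<open>\<Theta>\<close> a large deviation falls into one of the two tails.\<close>
  have q: "q \<le> \<gamma> + S"
  proof -
    let ?A = "{x \<in> \<Theta>. mr + \<epsilon> < F x}" and ?B = "{x \<in> \<Theta>. F x < mr - \<epsilon>}"
    have sets: "space Q - \<Theta> \<in> sets Q" "?A \<in> sets Q" "?B \<in> sets Q" by measurable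
    have "q \<le> prob {\<omega> \<in> space P. T \<omega> \<in> (space Q - \<Theta>) \<union> ?A \<union> ?B}"
      unfolding q_def
    proof (rule finite_measure_mono)
      show "{\<omega> \<in> space P. \<bar>enn2ereal (risk \<rho> f (R (leave_out n (Z \<omega>) i))) - enn2ereal m\<bar> > ereal \<epsilon>}
          \<subseteq> {\<omega> \<in> space P. T \<omega> \<in> (space Q - \<Theta>) \<union> ?A \<union> ?B}"
      proof (rule subsetI, rule ccontr)
        fix \<omega> assume "\<omega> \<in> {\<omega> \<in> space P. \<bar>enn2ereal (risk \<rho> f (R (leave_out n (Z \<omega>) i))) - enn2ereal m\<bar> > ereal \<epsilon>}"
          and "\<omega> \<notin> {\<omega> \<in> space P. T \<omega> \<in> (space Q - \<Theta>) \<union> ?A \<union> ?B}"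
        hence \<omega>: "\<bar>enn2ereal (risk \<rho> f (R (leave_out n (Z \<omega>) i))) - enn2ereal m\<bar> > ereal \<epsilon>"
          and nin: "T \<omega> \<notin> ?A" "T \<omega> \<notin> ?B" "T \<omega> \<in> \<Theta>"
          using measurable_space[OF T] by auto
        have "enn2ereal (risk \<rho> f (R (leave_out n (Z \<omega>) i))) = ereal (F (T \<omega>))"
          using rk_F[OF nin(3)] F_nonneg by (simp add: ZT rk_def[symmetric])
        with \<omega> mr_nonneg have "\<epsilon> < \<bar>F (T \<omega>) - mr\<bar>" by (simp add: m)
        with nin show False by auto
      qed
    qed measurable
    also have "\<dots> = measure Q ((space Q - \<Theta>) \<union> ?A \<union> ?B)" using sets by (intro pull) auto
    finally have "q \<le> measure Q (space Q - \<Theta>) + measure Q ?A + measure Q ?B"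
      using measure_Un_le[of "space Q - \<Theta> \<union> ?A" Q ?B] measure_Un_le[of "space Q - \<Theta>" Q ?A] sets by auto
    moreover have "measure Q (space Q - \<Theta>) = \<gamma>" using p Q.prob_compl[OF \<Theta>] by (simp add: p_def)
    moreover have "measure Q ?A \<le> exp (- (2 * (\<epsilon> + \<delta>)\<^sup>2 / (c\<^sup>2 * real n)))"
      using \<delta>' \<epsilon>' by (intro up) auto
    moreover have "measure Q ?B \<le> exp (- (2 * (\<epsilon> - \<delta>)\<^sup>2 / (c\<^sup>2 * real n)))"
      using \<delta>' \<epsilon>' by (intro down) auto
    ultimately show ?thesis unfolding S_def by linarith
  qed
  define a where "a = \<epsilon> / (sqrt (2 * real n) * C1 * C2) - sqrt (2 * real n) * \<gamma>"
  define b where "b = \<epsilon> / (sqrt (8 * real n) * C1\<^sup>2) - sqrt (2 * real n) * \<gamma>"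
  define r where "r = sqrt (2 * real n)"
  have r: "0 < r" "r\<^sup>2 = 2 * real n" using n by (auto simp: r_def)
  have "0 \<le> \<gamma> * real n * c" using \<gamma> c by simp
  with \<epsilon>' have \<epsilon>0: "0 < \<epsilon>" by linarith
  \<comment> \<open>As \<open>r\<^sup>2 = 2 * n\<close>, the subtracted term
    \<open>r * \<gamma>\<close> is \<open>\<gamma> * n * c\<close> in units of
    \<open>r * C1 * C2\<close>. Hence \<open>a\<^sup>2\<close> is the exponent of the first tail
    bound.\<close>
  have a_alt: "a = (\<epsilon> - \<gamma> * real n * c) / (r * C1 * C2)"
  proof -
    have "\<gamma> * real n * c = r * \<gamma> * (r * C1 * C2)"
      using r(2) by (simp add: c_def power2_eq_square algebra_simps)
    moreover have "r * C1 * C2 \<noteq> 0" using r \<open>C1 > 0\<close> \<open>C2 > 0\<close> by simp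
    ultimately show ?thesis
      unfolding a_def r_def[symmetric] diff_divide_distrib by (metis nonzero_mult_div_cancel_right)
  qed
  have a0: "0 < a" using a_alt \<epsilon>' r \<open>C1 > 0\<close> \<open>C2 > 0\<close> by simp
  have a2: "a\<^sup>2 = 2 * (\<epsilon> - \<gamma> * real n * c)\<^sup>2 / (c\<^sup>2 * real n)"
    using r \<open>C1 > 0\<close> \<open>C2 > 0\<close> n by (simp add: a_alt power_divide power_mult_distrib c_def)
  have sqrt8: "sqrt (8 * real n) = 2 * r"
    using real_sqrt_mult[of 4 "2 * real n"] by (simp add: r_def)
  have "r * C1 * C2 \<le> 2 * r * C1\<^sup>2"
    using mult_left_mono[OF \<open>C2 \<le> 2 * C1\<close>, of "r * C1"] r \<open>C1 > 0\<close> by (simp add: power2_eq_square mult_ac)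
  hence "b \<le> a"
    unfolding a_def b_def sqrt8 r_def[symmetric] using \<epsilon>0 r \<open>C1 > 0\<close> \<open>C2 > 0\<close>
    by (intro diff_right_mono divide_left_mono) auto
  have qa: "q \<le> 2 * \<gamma> + 2 * exp (- (a\<^sup>2))"
    using q \<gamma> two_sided_tail_bounds(1)[OF _ c \<gamma> \<delta>'(1) \<epsilon>' \<delta>'(2)] n unfolding a2 S_def by simp
  \<comment> \<open>The condition says \<open>- a \<le> b\<close>. If it fails, then
    \<open>b < - a < 0\<close> and the bound with \<open>b\<close> is the smaller one, so the
    comparison of the two bounds is conditional.\<close>
  have ab: "b\<^sup>2 \<le> a\<^sup>2" if "0 \<le> a + b"
    using that \<open>b \<le> a\<close> by (intro power2_le_iff_abs_le[THEN iffD2]) auto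
  have qb: "q \<le> 2 * \<gamma> + 2 * exp (- (b\<^sup>2))"
  proof (cases "0 \<le> a + b")
    case True
    hence "exp (- (a\<^sup>2)) \<le> exp (- (b\<^sup>2))" using ab by simp
    with qa show ?thesis by linarith
  next
    case False
    show ?thesis
    proof (cases "\<gamma> \<le> 1 / 2")
      case True
      \<comment> \<open>Here \<open>b\<close> is negative, and dropping its positive part gives
        \<open>b\<^sup>2 \<le> 2 * n * \<gamma>\<^sup>2\<close>, the exponent of the second tail
        bound.\<close>
      have "- (r * \<gamma>) \<le> b" unfolding b_def r_def[symmetric] using \<epsilon>0 by simp
      hence "\<bar>b\<bar> \<le> r * \<gamma>" using False a0 \<open>b \<le> a\<close> by linarith
      hence "b\<^sup>2 \<le> (r * \<gamma>)\<^sup>2" using power_mono[of "\<bar>b\<bar>" "r * \<gamma>" 2] by simp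
      hence "exp (- (2 * real n * \<gamma>\<^sup>2)) \<le> exp (- (b\<^sup>2))" by (simp add: power_mult_distrib r)
      thus ?thesis
        using q two_sided_tail_bounds(2)[OF _ c \<gamma> \<delta>'(1) \<epsilon>' \<delta>'(2) True] n
        unfolding S_def by linarith
    next
      \<comment> \<open>For \<open>\<gamma> > 1 / 2\<close> the right side exceeds 1.\<close>
      case False
      have "q \<le> 1" by (simp add: q_def)
      thus ?thesis using False exp_gt_zero[of "- (b\<^sup>2)"] by linarith
    qed
  qed
  show ?thesis
    unfolding Let_def q_def[symmetric] a_def[symmetric] b_def[symmetric] using qa qb ab by auto
qed

end
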